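(* If $M$ and $N$ are $\mathcal{M}ol$-equivalent complete metric spaces, then $\dim M=\dim N$.
   Context: All vector spaces are over $\mathbb{R}$; $0_X$ denotes the zero vector of $X$. Free basis: given a Banach space $X$, a closed subset $M\subseteq X$ is a free basis of $X$ if $0_X\in M$ and for every Banach space $Y$ and every Lipschitz map $f:M\to Y$ with $f(0_X)=0_Y$ (where $M$ carries the metric induced by the norm of $X$) it is possible to uniquely extend $f$ to a bounded linear map $\hat f:X\to Y$. Two metric spaces are bi-Lipschitz isomorphic if there is a bijection between them that is Lipschitz and has Lipschitz inverse. $\mathcal{M}ol$-equivalence: two complete metric spaces $M$ and $N$ are $\mathcal{M}ol$-equivalent if there are free bases $M'$ and $N'$ of a common Banach space such that $M$ is bi-Lipschitz isomorphic to $M'$, $N$ is bi-Lipschitz isomorphic to $N'$, and $\operatorname{span} M'=\operatorname{span} N'$ (linear spans, not closed). $\dim$ denotes the Čech-Lebesgue covering dimension of the underlying topological space: $\dim Z\le n$ if every finite open cover of $Z$ has a finite open refinement such that each point lies in at most $n+1$ members; $\dim Z$ is the least such integer $n\ge -1$ (with $\dim Z=-1$ iff $Z=\emptyset$), or $\infty$ if there is none. *)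

theory Defs
  imports "HOL-Analysis.Analysis"
begin

section \<open>Covering dimension\<close>

definition open_cover :: "'a topology \<Rightarrow> 'a set set \<Rightarrow> bool" where
  "open_cover Z \<U> \<longleftrightarrow> (\<forall>U\<in>\<U>. openin Z U) \<and> \<Union>\<U> = topspace Z"

definition covering_dim_le :: "'a topology \<Rightarrow> int \<Rightarrow> bool" where
  "covering_dim_le Z n \<longleftrightarrow>
     (\<forall>\<U>. finite \<U> \<and> open_cover Z \<U> \<longrightarrow>
        (\<exists>\<V>. finite \<V> \<and> open_cover Z \<V> \<and> (\<forall>V\<in>\<V>. \<exists>U\<in>\<U>. V \<subseteq> U) \<and>
             (\<forall>x\<in>topspace Z. int (card {V\<in>\<V>. x \<in> V}) \<le> n + 1)))"

text \<open>
  An infimum of integers bounded below is attained, so this is the least admissible \<open>n\<close>;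
  the infimum of the empty set is \<open>\<infinity>\<close>.  (The library predicate \<open>dim_le\<close> is the small
  inductive dimension and is not used here.)
\<close>

definition covering_dim :: "'a topology \<Rightarrow> ereal" where
  "covering_dim Z = Inf {ereal (real_of_int n) | n. n \<ge> -1 \<and> covering_dim_le Z n}"

lemma covering_dim_le_mono: "covering_dim_le Z m \<Longrightarrow> m \<le> n \<Longrightarrow> covering_dim_le Z n"
  unfolding covering_dim_le_def by (smt (verit, best))

lemma covering_dim_le_minus_one: "covering_dim_le Z (-1) \<longleftrightarrow> topspace Z = {}"
proof
  assume *: "covering_dim_le Z (-1)"
  have "open_cover Z {topspace Z}" by (simp add: open_cover_def)
  with * obtain \<V> where "finite \<V>" and \<V>: "open_cover Z \<V>"
      and "\<forall>x\<in>topspace Z. int (card {V\<in>\<V>. x \<in> V}) \<le> 0"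
    unfolding covering_dim_le_def by (metis add.left_inverse finite.emptyI finite.insertI)
  then have "\<forall>x\<in>topspace Z. {V\<in>\<V>. x \<in> V} = {}" by simp
  with \<V> show "topspace Z = {}" unfolding open_cover_def by blast
next
  assume "topspace Z = {}"
  then show "covering_dim_le Z (-1)"
    unfolding covering_dim_le_def open_cover_def by (auto intro!: exI[of _ "{}"])
qed

lemma covering_dim_le_iff:
  assumes "n \<ge> -1"
  shows "covering_dim Z \<le> ereal (real_of_int n) \<longleftrightarrow> covering_dim_le Z n"
proof
  assume *: "covering_dim Z \<le> ereal (real_of_int n)"
  show "covering_dim_le Z n"
  proof (rule ccontr)
    assume neg: "\<not> covering_dim_le Z n"
    have "ereal (real_of_int (n + 1)) \<le> covering_dim Z"
      unfolding covering_dim_def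
    proof (rule Inf_greatest)
      fix y assume "y \<in> {ereal (real_of_int n) | n. n \<ge> -1 \<and> covering_dim_le Z n}"
      then obtain m where "y = ereal (real_of_int m)" "covering_dim_le Z m" by blast
      moreover from this have "\<not> m \<le> n" using neg covering_dim_le_mono by blast
      ultimately show "ereal (real_of_int (n + 1)) \<le> y" by simp
    qed
    then have "ereal (real_of_int (n + 1)) \<le> ereal (real_of_int n)" using * by (rule order_trans)
    then show False by simp
  qed
next
  assume "covering_dim_le Z n"
  with assms show "covering_dim Z \<le> ereal (real_of_int n)"
    unfolding covering_dim_def by (intro Inf_lower) blast
qed

section \<open>Banach spaces given by a carrier and operations\<close>

text \<open>
  The definition of a free basis quantifies over all Banach spaces.  A HOL predicate cannot
  quantify over types, so the Banach spaces quantified over are structures on subsets of a type.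
\<close>

record 'y normed_structure =
  ncarrier :: "'y set"
  nzero :: 'y
  nadd :: "'y \<Rightarrow> 'y \<Rightarrow> 'y"
  nscale :: "real \<Rightarrow> 'y \<Rightarrow> 'y"
  nnorm :: "'y \<Rightarrow> real"

definition ndist :: "'y normed_structure \<Rightarrow> 'y \<Rightarrow> 'y \<Rightarrow> real" where
  "ndist Y x y = nnorm Y (nadd Y x (nscale Y (-1) y))"

locale real_normed_structure =
  fixes Y :: "'y normed_structure"
  assumes zero_closed: "nzero Y \<in> ncarrier Y"
    and add_closed: "\<lbrakk>x \<in> ncarrier Y; y \<in> ncarrier Y\<rbrakk> \<Longrightarrow> nadd Y x y \<in> ncarrier Y"
    and scale_closed: "x \<in> ncarrier Y \<Longrightarrow> nscale Y a x \<in> ncarrier Y"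
    and add_assoc: "\<lbrakk>x \<in> ncarrier Y; y \<in> ncarrier Y; z \<in> ncarrier Y\<rbrakk>
          \<Longrightarrow> nadd Y (nadd Y x y) z = nadd Y x (nadd Y y z)"
    and add_commute: "\<lbrakk>x \<in> ncarrier Y; y \<in> ncarrier Y\<rbrakk> \<Longrightarrow> nadd Y x y = nadd Y y x"
    and add_zero: "x \<in> ncarrier Y \<Longrightarrow> nadd Y (nzero Y) x = x"
    and add_inverse: "x \<in> ncarrier Y \<Longrightarrow> \<exists>y\<in>ncarrier Y. nadd Y x y = nzero Y"
    and scale_add_right: "\<lbrakk>x \<in> ncarrier Y; y \<in> ncarrier Y\<rbrakk>
          \<Longrightarrow> nscale Y a (nadd Y x y) = nadd Y (nscale Y a x) (nscale Y a y)"
    and scale_add_left: "x \<in> ncarrier Y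
          \<Longrightarrow> nscale Y (a + b) x = nadd Y (nscale Y a x) (nscale Y b x)"
    and scale_scale: "x \<in> ncarrier Y \<Longrightarrow> nscale Y a (nscale Y b x) = nscale Y (a * b) x"
    and scale_one: "x \<in> ncarrier Y \<Longrightarrow> nscale Y 1 x = x"
    and norm_eq_zero: "x \<in> ncarrier Y \<Longrightarrow> nnorm Y x = 0 \<longleftrightarrow> x = nzero Y"
    and norm_scale: "x \<in> ncarrier Y \<Longrightarrow> nnorm Y (nscale Y a x) = \<bar>a\<bar> * nnorm Y x"
    and norm_triangle: "\<lbrakk>x \<in> ncarrier Y; y \<in> ncarrier Y\<rbrakk>
          \<Longrightarrow> nnorm Y (nadd Y x y) \<le> nnorm Y x + nnorm Y y"

locale banach_structure = real_normed_structure +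
  assumes complete: "\<lbrakk>\<And>n. s n \<in> ncarrier Y;
        \<And>\<epsilon>. \<epsilon> > 0 \<Longrightarrow> \<exists>N. \<forall>m\<ge>N. \<forall>n\<ge>N. ndist Y (s m) (s n) < \<epsilon>\<rbrakk>
      \<Longrightarrow> \<exists>l\<in>ncarrier Y. (\<lambda>n. ndist Y (s n) l) \<longlonglongrightarrow> 0"

definition lipschitz_into :: "'y normed_structure \<Rightarrow> 'x::metric_space set \<Rightarrow> ('x \<Rightarrow> 'y) \<Rightarrow> bool" where
  "lipschitz_into Y M f \<longleftrightarrow> f ` M \<subseteq> ncarrier Y \<and>
     (\<exists>L. \<forall>x\<in>M. \<forall>y\<in>M. ndist Y (f x) (f y) \<le> L * dist x y)"

definition bounded_linear_into :: "'y normed_structure \<Rightarrow> ('x::real_normed_vector \<Rightarrow> 'y) \<Rightarrow> bool" where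
  "bounded_linear_into Y F \<longleftrightarrow> range F \<subseteq> ncarrier Y \<and>
     (\<forall>x y. F (x + y) = nadd Y (F x) (F y)) \<and>
     (\<forall>a x. F (a *\<^sub>R x) = nscale Y a (F x)) \<and>
     (\<exists>K. \<forall>x. nnorm Y (F x) \<le> K * norm x)"

section \<open>Free bases and Mol-equivalence\<close>

text \<open>
  The target space \<open>Y\<close> ranges over all Banach spaces carried by a set of sequences in the
  ambient type.  No Banach space is lost up to isometric isomorphism: the closed linear span of
  \<open>f ` M\<close> has at most as many elements as there are such sequences.  Lemma
  \<open>free_basis_universal\<close> below derives the extension property for every type of class
  \<open>banach\<close> from this definition.
\<close>

definition free_basis :: "'x::banach set \<Rightarrow> bool" where
  "free_basis M \<longleftrightarrow> closed M \<and> 0 \<in> M \<and>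
     (\<forall>(Y :: (nat \<Rightarrow> 'x) normed_structure) f.
        banach_structure Y \<and> lipschitz_into Y M f \<and> f 0 = nzero Y \<longrightarrow>
        (\<exists>!F. bounded_linear_into Y F \<and> (\<forall>x\<in>M. F x = f x)))"

definition bi_lipschitz_isomorphic :: "'a metric \<Rightarrow> 'b metric \<Rightarrow> bool" where
  "bi_lipschitz_isomorphic M N \<longleftrightarrow>
     (\<exists>f g. Lipschitz_continuous_map M N f \<and> Lipschitz_continuous_map N M g \<and>
        (\<forall>x\<in>mspace M. g (f x) = x) \<and> (\<forall>y\<in>mspace N. f (g y) = y))"

text \<open>
  The type argument is the common Banach space.  In a theorem it is a free type variable, so that
  an assumption \<open>Mol_equivalent TYPE('x) M N\<close> amounts to the existence of such a space.
\<close>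

definition Mol_equivalent :: "'x::banach itself \<Rightarrow> 'a metric \<Rightarrow> 'b metric \<Rightarrow> bool" where
  "Mol_equivalent _ M N \<longleftrightarrow>
     (\<exists>M' N' :: 'x set. free_basis M' \<and> free_basis N' \<and>
        bi_lipschitz_isomorphic M (submetric euclidean_metric M') \<and>
        bi_lipschitz_isomorphic N (submetric euclidean_metric N') \<and>
        span M' = span N')"

section \<open>Universality of the extension property\<close>

lemma ex1_unique: "\<exists>!x. P x \<Longrightarrow> P a \<Longrightarrow> P b \<Longrightarrow> a = b"
  by blast

definition transported :: "('y::real_normed_vector \<Rightarrow> 'z) \<Rightarrow> 'y set \<Rightarrow> 'z normed_structure" where
  "transported e S =
     \<lparr>ncarrier = e ` S, nzero = e 0,
      nadd = (\<lambda>u v. e (inv_into S e u + inv_into S e v)),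
      nscale = (\<lambda>a u. e (a *\<^sub>R inv_into S e u)),
      nnorm = (\<lambda>u. norm (inv_into S e u))\<rparr>"

context
  fixes e :: "'y::banach \<Rightarrow> 'z" and S :: "'y set"
  assumes inj: "inj_on e S" and S: "subspace S" "closed S"
begin

lemma transported_simps:
  "ncarrier (transported e S) = e ` S"
  "nzero (transported e S) = e 0"
  "\<lbrakk>x \<in> S; y \<in> S\<rbrakk> \<Longrightarrow> nadd (transported e S) (e x) (e y) = e (x + y)"
  "x \<in> S \<Longrightarrow> nscale (transported e S) a (e x) = e (a *\<^sub>R x)"
  "x \<in> S \<Longrightarrow> nnorm (transported e S) (e x) = norm x"
  by (simp_all add: transported_def inv_into_f_f[OF inj])

lemma transported_dist:
  assumes "x \<in> S" "y \<in> S" shows "ndist (transported e S) (e x) (e y) = dist x y"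
proof -
  have "(-1) *\<^sub>R y \<in> S" "x + (-1) *\<^sub>R y \<in> S"
    using assms by (blast intro: subspace_add[OF S(1)] subspace_scale[OF S(1)])+
  with assms show ?thesis
    by (simp only: ndist_def transported_simps) (simp add: dist_norm)
qed

lemma banach_structure_transported: "banach_structure (transported e S)"
proof -
  note S_intros = subspace_0[OF S(1)] subspace_add[OF S(1)] subspace_scale[OF S(1)]
  let ?Y = "transported e S"
  have normed: "real_normed_structure ?Y"
  proof
    show "\<exists>y\<in>ncarrier ?Y. nadd ?Y x y = nzero ?Y" if x: "x \<in> ncarrier ?Y" for x
    proof -
      obtain x' where x': "x = e x'" "x' \<in> S" using x unfolding transported_simps by blast
      then have "- x' \<in> S" by (simp add: subspace_neg[OF S(1)])
      with x' show ?thesis by (auto simp: transported_simps intro!: bexI[of _ "- x'"])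
    qed
    show "(nnorm ?Y x = 0) = (x = nzero ?Y)" if x: "x \<in> ncarrier ?Y" for x
    proof -
      obtain x' where x': "x = e x'" "x' \<in> S" using x unfolding transported_simps by blast
      then show ?thesis using inj_onD[OF inj] S_intros(1) by (auto simp: transported_simps)
    qed
  qed (auto simp: transported_simps S_intros algebra_simps norm_triangle_ineq)
  show ?thesis
  proof (intro banach_structure.intro normed banach_structure_axioms.intro)
    fix s :: "nat \<Rightarrow> 'z" assume s: "\<And>n. s n \<in> ncarrier ?Y"
      and Cau: "\<And>\<epsilon>. \<epsilon> > 0 \<Longrightarrow> \<exists>N. \<forall>m\<ge>N. \<forall>n\<ge>N. ndist ?Y (s m) (s n) < \<epsilon>"
    define t where "t n = inv_into S e (s n)" for n
    have t: "t n \<in> S" "s n = e (t n)" for n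
      using s[of n] by (simp_all add: t_def transported_simps inv_into_into f_inv_into_f)
    have "Cauchy t"
      using Cau by (simp add: Cauchy_def t transported_dist)
    then obtain l where l: "t \<longlonglongrightarrow> l" using Cauchy_convergent convergent_def by blast
    have "l \<in> S" using closed_sequentially[OF S(2)] t l by blast
    moreover have "(\<lambda>n. dist (t n) l) \<longlonglongrightarrow> 0" using l by (rule iffD1[OF tendsto_dist_iff])
    ultimately show "\<exists>l\<in>ncarrier ?Y. (\<lambda>n. ndist ?Y (s n) l) \<longlonglongrightarrow> 0"
      by (auto simp: transported_simps t transported_dist intro!: bexI[of _ l])
  qed
qed

text \<open>The defining property of a free basis, pulled back along \<open>e\<close>.\<close>

lemma extension_transported:
  fixes M :: "'x::banach set" and f :: "'x \<Rightarrow> 'y"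
  assumes ex1: "\<And>f. \<lbrakk>lipschitz_into (transported e S) M f; f 0 = nzero (transported e S)\<rbrakk> \<Longrightarrow>
      \<exists>!F. bounded_linear_into (transported e S) F \<and> (\<forall>x\<in>M. F x = f x)"
    and f: "C-lipschitz_on M f" "f ` M \<subseteq> S" "f 0 = 0"
  shows "\<exists>!F. bounded_linear F \<and> range F \<subseteq> S \<and> (\<forall>x\<in>M. F x = f x)"
proof -
  let ?Y = "transported e S"
  have "lipschitz_into ?Y M (e \<circ> f)"
    unfolding lipschitz_into_def
  proof (intro conjI exI[of _ C] ballI)
    show "(e \<circ> f) ` M \<subseteq> ncarrier ?Y" using f(2) by (auto simp: transported_simps)
    fix x y assume xy: "x \<in> M" "y \<in> M"
    then have "f x \<in> S" "f y \<in> S" using f(2) by blast+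
    then show "ndist ?Y ((e \<circ> f) x) ((e \<circ> f) y) \<le> C * dist x y"
      using lipschitz_onD[OF f(1) xy] by (simp add: transported_dist)
  qed
  moreover have "(e \<circ> f) 0 = nzero ?Y" by (simp add: f(3) transported_simps)
  ultimately have ex1: "\<exists>!F. bounded_linear_into ?Y F \<and> (\<forall>x\<in>M. F x = (e \<circ> f) x)"
    by (rule ex1)
  have into: "bounded_linear_into ?Y (e \<circ> G)" if "bounded_linear G" "range G \<subseteq> S" for G :: "'x \<Rightarrow> 'y"
  proof -
    interpret G: bounded_linear G by fact
    have G: "G x \<in> S" for x using that(2) by blast
    obtain K where "norm (G x) \<le> norm x * K" for x using G.bounded by blast
    then show ?thesis
      unfolding bounded_linear_into_def
      by (auto simp: transported_simps G G.add G.scaleR mult.commute intro!: exI[of _ K])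
  qed
  obtain F where F: "bounded_linear_into ?Y F" "\<And>x. x \<in> M \<Longrightarrow> F x = e (f x)"
    using ex1 by auto
  define G where "G x = inv_into S e (F x)" for x
  have FG: "F x = e (G x)" "G x \<in> S" for x
    using F(1) by (auto simp: G_def bounded_linear_into_def transported_simps inv_into_into f_inv_into_f
        image_subset_iff)
  have add: "G (x + y) = G x + G y" for x y
  proof (rule inj_onD[OF inj])
    show "e (G (x + y)) = e (G x + G y)"
      using F(1) by (simp add: bounded_linear_into_def transported_simps FG)
  qed (simp_all add: FG subspace_add[OF S(1)])
  have scale: "G (a *\<^sub>R x) = a *\<^sub>R G x" for a x
  proof (rule inj_onD[OF inj])
    show "e (G (a *\<^sub>R x)) = e (a *\<^sub>R G x)"
      using F(1) by (simp add: bounded_linear_into_def transported_simps FG)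
  qed (simp_all add: FG subspace_scale[OF S(1)])
  obtain K where "nnorm ?Y (F x) \<le> K * norm x" for x
    using F(1) unfolding bounded_linear_into_def by blast
  then have "norm (G x) \<le> norm x * K" for x
    by (simp add: FG transported_simps mult.commute)
  then have "bounded_linear G" using add scale by (rule bounded_linear_intro[rotated 2])
  moreover have "G x = f x" if "x \<in> M" for x
    using F(2)[OF that] that f(2) FG inj_onD[OF inj] by (metis image_subset_iff)
  ultimately have 1: "bounded_linear G \<and> range G \<subseteq> S \<and> (\<forall>x\<in>M. G x = f x)"
    using FG by auto
  have uniq: "H = G" if H: "bounded_linear H" "range H \<subseteq> S" "\<forall>x\<in>M. H x = f x" for H
  proof -
    have "e \<circ> H = e \<circ> G"
    proof -
      have "bounded_linear_into ?Y (e \<circ> H) \<and> (\<forall>x\<in>M. (e \<circ> H) x = (e \<circ> f) x)"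
        using into[OF H(1,2)] H(3) by simp
      moreover have "bounded_linear_into ?Y (e \<circ> G) \<and> (\<forall>x\<in>M. (e \<circ> G) x = (e \<circ> f) x)"
        using into[of G] 1 by simp
      ultimately show ?thesis by (rule ex1_unique[OF ex1, of "e \<circ> H" "e \<circ> G"])
    qed
    then have "e (H x) = e (G x)" for x by (simp add: fun_eq_iff)
    then show ?thesis using inj_onD[OF inj] H(2) FG(2) by (simp add: fun_eq_iff image_subset_iff)
  qed
  show ?thesis by (rule ex1I[of _ G]) (use 1 in simp, simp add: uniq)
qed

end

lemma subspace_closure_normed:
  fixes S :: "'y::real_normed_vector set"
  assumes "subspace S" shows "subspace (closure S)"
proof (rule subspaceI)
  show "0 \<in> closure S" using closure_subset subspace_0[OF assms] by (rule subsetD)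
  show "x + y \<in> closure S" if xy: "x \<in> closure S" "y \<in> closure S" for x y
  proof -
    from xy(1) obtain u where u: "\<forall>n. u n \<in> S" "u \<longlonglongrightarrow> x" unfolding closure_sequential by (elim exE conjE)
    from xy(2) obtain w where w: "\<forall>n. w n \<in> S" "w \<longlonglongrightarrow> y" unfolding closure_sequential by (elim exE conjE)
    have "\<forall>n. u n + w n \<in> S" using u(1) w(1) subspace_add[OF assms] by simp
    moreover have "(\<lambda>n. u n + w n) \<longlonglongrightarrow> x + y" using u(2) w(2) by (rule tendsto_add)
    ultimately show ?thesis unfolding closure_sequential by (intro exI[of _ "\<lambda>n. u n + w n"] conjI)
  qed
  show "c *\<^sub>R x \<in> closure S" if x: "x \<in> closure S" for c x
  proof -
    from x obtain u where u: "\<forall>n. u n \<in> S" "u \<longlonglongrightarrow> x" unfolding closure_sequential by (elim exE conjE)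
    have "\<forall>n. c *\<^sub>R u n \<in> S" using u(1) subspace_scale[OF assms] by simp
    moreover have "(\<lambda>n. c *\<^sub>R u n) \<longlonglongrightarrow> c *\<^sub>R x" using tendsto_const u(2) by (rule tendsto_scaleR)
    ultimately show ?thesis unfolding closure_sequential by (intro exI[of _ "\<lambda>n. c *\<^sub>R u n"] conjI)
  qed
qed

lemma in_closure_span_imp_series:
  fixes A :: "'y::real_normed_vector set"
  assumes "y \<in> closure (span A)" "A \<noteq> {}"
  shows "\<exists>(a :: nat \<Rightarrow> nat \<Rightarrow> 'y) r k. range (\<lambda>(n, i). a n i) \<subseteq> A \<and>
           (\<lambda>n. \<Sum>i<k n. r n i *\<^sub>R a n i) \<longlonglongrightarrow> y"
proof -
  have *: "\<exists>(a :: nat \<Rightarrow> 'y) r k. range a \<subseteq> A \<and> z = (\<Sum>i<k. r i *\<^sub>R a i)" if z: "z \<in> span A" for z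
  proof -
    obtain t r where t: "finite t" "t \<subseteq> A" "z = (\<Sum>a\<in>t. r a *\<^sub>R a)"
      using z unfolding span_explicit by blast
    obtain h where h: "bij_betw h {..<card t} t"
      using ex_bij_betw_nat_finite[OF t(1)] by (auto simp: atLeast0LessThan)
    obtain a0 where "a0 \<in> A" using assms(2) by blast
    define a where "a i = (if i < card t then h i else a0)" for i
    have "range a \<subseteq> A"
      using h t(2) \<open>a0 \<in> A\<close> by (auto simp: a_def bij_betw_def)
    moreover have "z = (\<Sum>i<card t. r (a i) *\<^sub>R a i)"
      unfolding t(3) using sum.reindex_bij_betw[OF h, of "\<lambda>a. r a *\<^sub>R a"] by (simp add: a_def)
    ultimately show ?thesis
      by (intro exI[of _ a] exI[of _ "\<lambda>i. r (a i)"] exI[of _ "card t"] conjI)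
  qed
  obtain z where z: "\<And>n. z n \<in> span A" "z \<longlonglongrightarrow> y"
    using assms(1) unfolding closure_sequential by blast
  have "\<forall>n. \<exists>a r k. range (a :: nat \<Rightarrow> 'y) \<subseteq> A \<and> z n = (\<Sum>i<k. r i *\<^sub>R a i)"
    using *[OF z(1)] by (rule allI)
  then have "\<exists>a r k. \<forall>n. range (a n :: nat \<Rightarrow> 'y) \<subseteq> A \<and> z n = (\<Sum>i<k n. r n i *\<^sub>R a n i)"
    by (simp only: choice_iff)
  then obtain a r k where *: "\<forall>n. range (a n :: nat \<Rightarrow> 'y) \<subseteq> A \<and> z n = (\<Sum>i<k n. r n i *\<^sub>R a n i)"
    by (elim exE)
  from * have ark: "range (a n) \<subseteq> A" "z n = (\<Sum>i<k n. r n i *\<^sub>R a n i)" for n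
    by (rule allE[of _ n], simp)+
  have "(\<lambda>n. \<Sum>i<k n. r n i *\<^sub>R a n i) = z" by (simp add: ark(2) fun_eq_iff)
  with z(2) have "(\<lambda>n. \<Sum>i<k n. r n i *\<^sub>R a n i) \<longlonglongrightarrow> y" by simp
  moreover have "range (\<lambda>(n, i). a n i) \<subseteq> A" using ark(1) by auto
  ultimately show ?thesis by (intro exI[of _ a] exI[of _ r] exI[of _ k] conjI)
qed

lemma ex_inj_on_closure_span:
  fixes f :: "'x::real_normed_vector \<Rightarrow> 'y::real_normed_vector"
  assumes "0 \<in> M" "f 0 = 0"
  shows "\<exists>e :: 'y \<Rightarrow> nat \<Rightarrow> 'x. inj_on e (closure (span (f ` M)))"
proof (cases "\<exists>v::'x. v \<noteq> 0")
  case True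
  then obtain v :: 'x where v: "v \<noteq> 0" by blast
  define \<rho> where "\<rho> x = (SOME r. x = r *\<^sub>R v)" for x
  have \<rho>: "\<rho> (r *\<^sub>R v) = r" for r
    unfolding \<rho>_def using v by (intro some_equality) auto
  define p where "p j n i = prod_encode (j :: nat, prod_encode (n :: nat, i :: nat))" for j n i
  define d where "d c = lim (\<lambda>n. \<Sum>i<nat \<lfloor>\<rho> (c (p 2 n 0))\<rfloor>. \<rho> (c (p 1 n i)) *\<^sub>R f (c (p 0 n i)))" for c
  have "closure (span (f ` M)) \<subseteq> range d"
  proof
    fix y assume "y \<in> closure (span (f ` M))"
    then obtain a :: "nat \<Rightarrow> nat \<Rightarrow> 'y" and r k
      where a: "range (\<lambda>(n, i). a n i) \<subseteq> f ` M"
        and y: "(\<lambda>n. \<Sum>i<k n. r n i *\<^sub>R a n i) \<longlonglongrightarrow> y"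
      using in_closure_span_imp_series[of y "f ` M"] assms(1) by blast
    have "\<forall>n i. \<exists>m. a n i = f m" using a by blast
    then obtain m where m: "\<And>n i. a n i = f (m n i)" by metis
    define c where "c q = (let (j, s) = prod_decode q; (n, i) = prod_decode s in
        if j = 0 then m n i else if j = 1 then r n i *\<^sub>R v else real (k n) *\<^sub>R v)" for q
    have "c (p 0 n i) = m n i" "c (p 1 n i) = r n i *\<^sub>R v" "c (p 2 n i) = real (k n) *\<^sub>R v" for n i
      by (simp_all add: c_def p_def)
    then have "d c = lim (\<lambda>n. \<Sum>i<k n. r n i *\<^sub>R a n i)"
      by (simp add: d_def \<rho> m)
    also have "\<dots> = y" using y by (rule limI)
    finally show "y \<in> range d" by blast
  qed
  then show ?thesis by (blast intro: inj_on_inv_into)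
next
  case False
  then have x0: "x = 0" for x :: 'x by blast
  have "f x = 0" for x using assms(2) by (subst x0[of x])
  then have "span (f ` M) \<subseteq> {0}" by (intro span_minimal) (auto simp: subspace_def)
  then have "closure (span (f ` M)) \<subseteq> {0}" by (intro closure_minimal) auto
  then have "inj_on (\<lambda>_. \<lambda>_. 0) (closure (span (f ` M)))" by (auto simp: inj_on_def)
  then show ?thesis by blast
qed

theorem free_basis_universal:
  fixes M :: "'x::banach set" and f :: "'x \<Rightarrow> 'y::banach"
  assumes M: "free_basis M" and f: "C-lipschitz_on M f" "f 0 = 0"
  shows "\<exists>!F. bounded_linear F \<and> (\<forall>x\<in>M. F x = f x)"
proof -
  have 0: "0 \<in> M" using M by (simp add: free_basis_def)
  have ext: "\<exists>!F. bounded_linear F \<and> range F \<subseteq> S \<and> (\<forall>x\<in>M. F x = g x)"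
    if S: "subspace S" "closed S" and e: "inj_on e S"
      and g: "D-lipschitz_on M g" "g ` M \<subseteq> S" "g 0 = 0"
    for S :: "'y set" and e :: "'y \<Rightarrow> nat \<Rightarrow> 'x" and g D
    using M banach_structure_transported[OF e S]
    by (intro extension_transported[OF e S _ g]) (simp add: free_basis_def)
  have ex: "\<exists>F. bounded_linear F \<and> (\<forall>x\<in>M. F x = f x)"
  proof -
    let ?S = "closure (span (f ` M))"
    obtain e :: "'y \<Rightarrow> nat \<Rightarrow> 'x" where e: "inj_on e ?S"
      using ex_inj_on_closure_span[OF 0, where f = f, OF f(2)] by (elim exE)
    have fM: "f ` M \<subseteq> ?S" by (rule order_trans[OF span_superset closure_subset])
    have "\<exists>!F. bounded_linear F \<and> range F \<subseteq> ?S \<and> (\<forall>x\<in>M. F x = f x)"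
      by (rule ext[where g = f, OF subspace_closure_normed[OF subspace_span] closed_closure e f(1) fM f(2)])
    then obtain F where "bounded_linear F \<and> range F \<subseteq> ?S \<and> (\<forall>x\<in>M. F x = f x)" by (rule ex1E)
    then show ?thesis by (intro exI[of _ F]) simp
  qed
  have uniq: "F = G"
    if F: "bounded_linear F" "\<forall>x\<in>M. F x = f x" and G: "bounded_linear G" "\<forall>x\<in>M. G x = f x" for F G
  proof -
    define H where "H x = F x - G x" for x
    have H: "bounded_linear H"
      unfolding H_def using F(1) G(1) by (rule bounded_linear_sub)
    let ?S = "closure (range H)"
    have S: "subspace ?S"
      using linear_subspace_image[OF bounded_linear.linear[OF H] subspace_UNIV]
      by (rule subspace_closure_normed)
    have "?S \<subseteq> range (\<lambda>c. lim (\<lambda>n. H (c n)))"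
    proof
      fix y assume "y \<in> ?S"
      then obtain z where z: "\<forall>n. z n \<in> range H" "z \<longlonglongrightarrow> y" unfolding closure_sequential by blast
      then have "\<forall>n. \<exists>x. z n = H x" by blast
      then obtain c where "\<And>n. z n = H (c n)" by metis
      then have "z = (\<lambda>n. H (c n))" by (simp add: fun_eq_iff)
      with z(2) have "y = lim (\<lambda>n. H (c n))" by (simp add: limI)
      then show "y \<in> range (\<lambda>c. lim (\<lambda>n. H (c n)))" by (intro image_eqI[of _ _ c]) simp_all
    qed
    then have e: "inj_on (inv (\<lambda>c. lim (\<lambda>n. H (c n)))) ?S" by (rule inj_on_inv_into)
    have "0 \<in> ?S" using S by (rule subspace_0)
    then have ex1: "\<exists>!K. bounded_linear K \<and> range K \<subseteq> ?S \<and> (\<forall>x\<in>M. K x = 0)"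
      by (intro ext[OF S closed_closure e, where D = 0]) (simp_all add: lipschitz_on_def image_subset_iff)
    have Hz: "bounded_linear H \<and> range H \<subseteq> ?S \<and> (\<forall>x\<in>M. H x = 0)"
      using H F(2) G(2) closure_subset[of "range H"] by (simp add: H_def)
    have Zz: "bounded_linear (\<lambda>_::'x. 0::'y) \<and> range (\<lambda>_::'x. 0::'y) \<subseteq> ?S \<and> (\<forall>x\<in>M. (0::'y) = 0)"
      using \<open>0 \<in> ?S\<close> by (simp add: bounded_linear_zero image_subset_iff)
    have "H = (\<lambda>_. 0)"
      by (rule ex1_unique[where P = "\<lambda>K. bounded_linear K \<and> range K \<subseteq> ?S \<and> (\<forall>x\<in>M. K x = 0)", OF ex1 Hz Zz])
    then show "F = G" by (simp add: H_def fun_eq_iff)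
  qed
  show ?thesis using ex by (rule ex_ex1I) (use uniq in simp)
qed

end

theory Submission
  imports Defs "HOL-Probability.Discrete_Topology"
begin

text \<open>
  Let \<open>M\<close> and \<open>N\<close> be free bases with the same linear span.  Every point of \<open>N - {0}\<close> is a
  finite linear combination of points of \<open>M - {0}\<close>, and conversely.  Testing with extensions of
  Lipschitz bump functions shows that the points occurring in such a combination depend in a
  Lipschitz way on the combined vector, as long as coefficients and mutual distances stay bounded
  below.  By linear independence each \<open>y\<close> in \<open>N - {0}\<close> occurs in the combination of some \<open>x\<close>
  that occurs in the combination of \<open>y\<close>; hence the relation ``\<open>x\<close> occurs in \<open>y\<close> and
  \<open>y\<close> occurs in \<open>x\<close>'' splits into small bi-Lipschitz pieces.  By completeness the closures of
  these pieces identify closed subsets of \<open>N\<close> with closed subsets of \<open>M\<close>.  So \<open>N\<close> is a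
  \<open>\<sigma>\<close>-discrete union of closed sets of dimension at most \<open>dim M\<close>, and the sum theorems for
  covering dimension give \<open>dim N \<le> dim M\<close>.
\<close>

section \<open>Covering dimension: subspaces and sums\<close>

text \<open>A refinement can be indexed by the cover itself: each refining set is assigned to one
  member that contains it, and sets with the same assignment are merged. Distinct indices at a point
  come from distinct refining sets, so merging does not raise the multiplicity. The fixed index set
  is what allows covers to be glued and to be refined repeatedly below.\<close>

lemma covering_dim_le_family:
  assumes dim: "covering_dim_le Z n" and I: "finite I"
    and U': "\<forall>i\<in>I. openin Z (U i)" "(\<Union>i\<in>I. U i) = topspace Z"
  shows "\<exists>V. (\<forall>i\<in>I. openin Z (V i)) \<and>
    (\<forall>i\<in>I. V i \<subseteq> U i) \<and>
    (\<Union>i\<in>I. V i) = topspace Z \<and>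
    (\<forall>x\<in>topspace Z. int (card {i\<in>I. x \<in> V i}) \<le> n + 1)"
proof -
  note U = U'[rule_format]
  have "finite (U ` I)" "open_cover Z (U ` I)"
    using I U by (auto simp: open_cover_def)
  then obtain \<V> where \<V>: "finite \<V>" "open_cover Z \<V>" "\<forall>V\<in>\<V>. \<exists>W\<in>U ` I. V \<subseteq> W"
      "\<forall>x\<in>topspace Z. int (card {V\<in>\<V>. x \<in> V}) \<le> n + 1"
    using dim[unfolded covering_dim_le_def, THEN spec, of "U ` I"] by (elim impE exE conjE) auto
  from \<V>(3) have "\<forall>V\<in>\<V>. \<exists>i\<in>I. V \<subseteq> U i" by blast
  then obtain c where c: "\<And>V. V \<in> \<V> \<Longrightarrow> c V \<in> I \<and> V \<subseteq> U (c V)" by metis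
  let ?V = "\<lambda>i. \<Union>{V\<in>\<V>. c V = i}"
  show ?thesis
  proof (intro exI[of _ ?V] conjI ballI)
    show "openin Z (?V i)" if "i \<in> I" for i
      using \<V>(2) by (auto simp: open_cover_def)
    show "?V i \<subseteq> U i" for i using c by blast
    have "(\<Union>i\<in>I. ?V i) = \<Union>\<V>" using c by blast
    then show "(\<Union>i\<in>I. ?V i) = topspace Z" using \<V>(2) by (simp add: open_cover_def)
    fix x assume x: "x \<in> topspace Z"
    have "card {i\<in>I. x \<in> ?V i} \<le> card (c ` {V\<in>\<V>. x \<in> V})"
      using \<V>(1) by (intro card_mono) auto
    also have "\<dots> \<le> card {V\<in>\<V>. x \<in> V}" using \<V>(1) by (intro card_image_le) auto
    finally show "int (card {i\<in>I. x \<in> ?V i}) \<le> n + 1" using \<V>(4) x by fastforce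
  qed
qed

text \<open>The converse passage from shrinkings to refinements: forgetting the indices can only
  identify members, which lowers the multiplicity.\<close>

lemma covering_dim_leI:
  assumes "\<And>\<U>. \<lbrakk>finite \<U>; open_cover Z \<U>\<rbrakk> \<Longrightarrow>
    \<exists>V. (\<forall>U\<in>\<U>. openin Z (V U) \<and> V U \<subseteq> U) \<and> (\<Union>U\<in>\<U>. V U) = topspace Z \<and>
        (\<forall>x\<in>topspace Z. int (card {U\<in>\<U>. x \<in> V U}) \<le> n + 1)"
  shows "covering_dim_le Z n"
  unfolding covering_dim_le_def
proof (intro allI impI, elim conjE)
  fix \<U> assume \<U>: "finite \<U>" "open_cover Z \<U>"
  from assms[OF \<U>] obtain V where V: "\<forall>U\<in>\<U>. openin Z (V U) \<and> V U \<subseteq> U" "(\<Union>U\<in>\<U>. V U) = topspace Z"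
      "\<forall>x\<in>topspace Z. int (card {U\<in>\<U>. x \<in> V U}) \<le> n + 1"
    by (elim exE conjE)
  have "int (card {W \<in> V ` \<U>. x \<in> W}) \<le> n + 1" if x: "x \<in> topspace Z" for x
  proof -
    have "card {W \<in> V ` \<U>. x \<in> W} \<le> card (V ` {U\<in>\<U>. x \<in> V U})"
      using \<U>(1) by (intro card_mono) auto
    also have "\<dots> \<le> card {U\<in>\<U>. x \<in> V U}" using \<U>(1) by (intro card_image_le) auto
    finally show ?thesis using bspec[OF V(3) x] by linarith
  qed
  then show "\<exists>\<V>. finite \<V> \<and> open_cover Z \<V> \<and> (\<forall>V\<in>\<V>. \<exists>U\<in>\<U>. V \<subseteq> U) \<and>
      (\<forall>x\<in>topspace Z. int (card {V\<in>\<V>. x \<in> V}) \<le> n + 1)"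
    using \<U>(1) V(1,2) by (intro exI[of _ "V ` \<U>"]) (auto simp: open_cover_def)
qed

lemma covering_dim_le_homeomorphic:
  assumes hom: "Z homeomorphic_space Z'" and dim: "covering_dim_le Z n"
  shows "covering_dim_le Z' n"
proof (rule covering_dim_leI)
  fix \<U> assume \<U>: "finite \<U>" "open_cover Z' \<U>"
  obtain f g where f: "continuous_map Z Z' f" and g: "continuous_map Z' Z g"
    and gf: "\<And>x. x \<in> topspace Z \<Longrightarrow> g (f x) = x" and fg: "\<And>y. y \<in> topspace Z' \<Longrightarrow> f (g y) = y"
    using hom unfolding homeomorphic_space_def homeomorphic_maps_def by blast
  have maps: "f x \<in> topspace Z'" "g y \<in> topspace Z" if "x \<in> topspace Z" "y \<in> topspace Z'" for x y
    using that f g by (auto simp: continuous_map_def)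
  have 1: "\<forall>U\<in>\<U>. openin Z {x \<in> topspace Z. f x \<in> U}"
    using \<U>(2) f by (auto simp: open_cover_def intro: openin_continuous_map_preimage)
  have 2: "(\<Union>U\<in>\<U>. {x \<in> topspace Z. f x \<in> U}) = topspace Z"
  proof -
    have "\<exists>U\<in>\<U>. f x \<in> U" if "x \<in> topspace Z" for x
      using f that \<U>(2) by (auto simp: open_cover_def continuous_map_def)
    then show ?thesis by blast
  qed
  from covering_dim_le_family[OF dim \<U>(1) 1 2] obtain V where V': "\<forall>U\<in>\<U>. openin Z (V U)" "\<forall>U\<in>\<U>. V U \<subseteq> {x \<in> topspace Z. f x \<in> U}"
      "(\<Union>U\<in>\<U>. V U) = topspace Z" "\<forall>x\<in>topspace Z. int (card {U\<in>\<U>. x \<in> V U}) \<le> n + 1"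
    by (elim exE conjE)
  note V = V'[rule_format]
  define W where "W U = {y \<in> topspace Z'. g y \<in> V U}" for U
  have "openin Z' (W U)" if "U \<in> \<U>" for U
    unfolding W_def by (rule openin_continuous_map_preimage[OF g V(1)[OF that]])
  moreover have "W U \<subseteq> U" if "U \<in> \<U>" for U
    using V(2)[OF that] fg by (force simp: W_def)
  moreover have "(\<Union>U\<in>\<U>. W U) = topspace Z'"
  proof -
    have "\<exists>U\<in>\<U>. g y \<in> V U" if "y \<in> topspace Z'" for y
      using V(3) g that by (auto simp: continuous_map_def)
    then show ?thesis by (auto simp: W_def)
  qed
  moreover have "int (card {U\<in>\<U>. y \<in> W U}) \<le> n + 1" if "y \<in> topspace Z'" for y
  proof -
    have "g y \<in> topspace Z" using g that by (auto simp: continuous_map_def)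
    from V(4)[OF this] show ?thesis using that by (simp add: W_def)
  qed
  ultimately show "\<exists>V. (\<forall>U\<in>\<U>. openin Z' (V U) \<and> V U \<subseteq> U) \<and> (\<Union>U\<in>\<U>. V U) = topspace Z' \<and>
      (\<forall>x\<in>topspace Z'. int (card {U\<in>\<U>. x \<in> V U}) \<le> n + 1)"
    by (intro exI[of _ W] conjI ballI) simp_all
qed

lemma covering_dim_homeomorphic:
  assumes "Z homeomorphic_space Z'"
  shows "covering_dim Z = covering_dim Z'"
proof -
  have "covering_dim_le Z n \<longleftrightarrow> covering_dim_le Z' n" for n
    using covering_dim_le_homeomorphic[OF assms]
      covering_dim_le_homeomorphic[OF assms[THEN iffD1[OF homeomorphic_space_sym]]] by (rule iffI)
  then show ?thesis by (simp add: covering_dim_def)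
qed

section \<open>Closed subspaces and disjoint open unions\<close>

lemma covering_dim_le_closed_subtopology:
  assumes dim: "covering_dim_le Z n" and A: "closedin Z A"
  shows "covering_dim_le (subtopology Z A) n"
proof (rule covering_dim_leI)
  fix \<U> assume \<U>: "finite \<U>" "open_cover (subtopology Z A) \<U>"
  have topA: "topspace (subtopology Z A) = A" using closedin_subset[OF A] by (simp add: Int_absorb1)
  from \<U>(2) have "\<forall>U\<in>\<U>. \<exists>T. openin Z T \<and> U = T \<inter> A"
    by (auto simp: open_cover_def openin_subtopology)
  then obtain T where T: "\<And>U. U \<in> \<U> \<Longrightarrow> openin Z (T U) \<and> U = T U \<inter> A" by metis
  define O' where "O' = case_option (topspace Z - A) T"
  define I where "I = insert None (Some ` \<U>)"
  have I: "finite I" using \<U>(1) by (simp add: I_def)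
  have 1: "\<forall>i\<in>I. openin Z (O' i)"
    using T A by (auto simp: I_def O'_def openin_diff)
  have 2: "(\<Union>i\<in>I. O' i) = topspace Z"
  proof -
    have "A = \<Union>\<U>" using \<U>(2) topA by (simp add: open_cover_def)
    moreover have "U \<subseteq> T U" "T U \<subseteq> topspace Z" if "U \<in> \<U>" for U
      using T[OF that] openin_subset by blast+
    moreover have "(\<Union>i\<in>I. O' i) = (topspace Z - A) \<union> (\<Union>U\<in>\<U>. T U)" by (simp add: I_def O'_def)
    ultimately show ?thesis by blast
  qed
  from covering_dim_le_family[OF dim I 1 2] obtain V where V': "\<forall>i\<in>I. openin Z (V i)" "\<forall>i\<in>I. V i \<subseteq> O' i"
      "(\<Union>i\<in>I. V i) = topspace Z" "\<forall>x\<in>topspace Z. int (card {i\<in>I. x \<in> V i}) \<le> n + 1"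
    by (elim exE conjE)
  note V = V'[rule_format]
  define W where "W U = V (Some U) \<inter> A" for U
  have VT: "V (Some U) \<subseteq> T U" if "U \<in> \<U>" for U
    using V(2)[of "Some U"] that by (auto simp: I_def O'_def)
  have "openin (subtopology Z A) (W U) \<and> W U \<subseteq> U" if "U \<in> \<U>" for U
    using V(1)[of "Some U"] VT[OF that] T[OF that] that
    by (auto simp: I_def W_def openin_subtopology)
  moreover have "(\<Union>U\<in>\<U>. W U) = A"
  proof -
    have "V None \<inter> A = {}" using V(2)[of None] by (auto simp: I_def O'_def)
    moreover have "A \<subseteq> topspace Z" using A by (rule closedin_subset)
    ultimately have "A \<subseteq> (\<Union>U\<in>\<U>. V (Some U))" using V(3) by (auto simp: I_def)
    then show ?thesis by (auto simp: W_def)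
  qed
  moreover have "int (card {U\<in>\<U>. x \<in> W U}) \<le> n + 1" if "x \<in> A" for x
  proof -
    have "card {U\<in>\<U>. x \<in> W U} = card (Some ` {U\<in>\<U>. x \<in> W U})"
      by (simp add: card_image)
    also have "\<dots> \<le> card {i\<in>I. x \<in> V i}"
      using I by (intro card_mono) (auto simp: I_def W_def)
    finally show ?thesis using V(4)[of x] that A closedin_subset by fastforce
  qed
  ultimately show "\<exists>V. (\<forall>U\<in>\<U>. openin (subtopology Z A) (V U) \<and> V U \<subseteq> U) \<and>
      (\<Union>U\<in>\<U>. V U) = topspace (subtopology Z A) \<and>
      (\<forall>x\<in>topspace (subtopology Z A). int (card {U\<in>\<U>. x \<in> V U}) \<le> n + 1)"
    unfolding topA by (intro exI[of _ W] conjI ballI) simp_all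
qed

text \<open>Shrinkings chosen independently on the pieces are united index by index. A point lies in
  one piece only, so its multiplicity is the one computed there.\<close>

lemma covering_dim_le_disjoint_open_Union:
  assumes S: "\<And>a. a \<in> A \<Longrightarrow> openin Z (S a)" "(\<Union>a\<in>A. S a) = topspace Z"
      "disjoint_family_on S A"
    and dim: "\<And>a. a \<in> A \<Longrightarrow> covering_dim_le (subtopology Z (S a)) n"
  shows "covering_dim_le Z n"
proof (rule covering_dim_leI)
  fix \<U> assume \<U>: "finite \<U>" "open_cover Z \<U>"
  have "\<exists>V. (\<forall>U\<in>\<U>. openin Z (V U) \<and> V U \<subseteq> U \<inter> S a) \<and> (\<Union>U\<in>\<U>. V U) = S a \<and>
      (\<forall>x\<in>S a. int (card {U\<in>\<U>. x \<in> V U}) \<le> n + 1)" if a: "a \<in> A" for a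
  proof -
    let ?Z = "subtopology Z (S a)"
    have top: "topspace ?Z = S a" using openin_subset[OF S(1)[OF a]] by (simp add: Int_absorb1)
    have 1: "\<forall>U\<in>\<U>. openin ?Z (U \<inter> S a)"
      using \<U>(2) by (auto simp: open_cover_def openin_subtopology_Int)
    have 2: "(\<Union>U\<in>\<U>. U \<inter> S a) = topspace ?Z"
      using \<U>(2) by (auto simp: open_cover_def)
    from covering_dim_le_family[OF dim[OF a] \<U>(1) 1 2] obtain V where "\<forall>U\<in>\<U>. openin ?Z (V U)" "\<forall>U\<in>\<U>. V U \<subseteq> U \<inter> S a"
      "(\<Union>U\<in>\<U>. V U) = topspace ?Z" "\<forall>x\<in>topspace ?Z. int (card {U\<in>\<U>. x \<in> V U}) \<le> n + 1"
      by (elim exE conjE)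
    then show ?thesis
      unfolding top using openin_trans_full[OF _ S(1)[OF a]] by (intro exI[of _ V] conjI ballI) simp_all
  qed
  then have "\<forall>a\<in>A. \<exists>V. (\<forall>U\<in>\<U>. openin Z (V U) \<and> V U \<subseteq> U \<inter> S a) \<and> (\<Union>U\<in>\<U>. V U) = S a \<and>
      (\<forall>x\<in>S a. int (card {U\<in>\<U>. x \<in> V U}) \<le> n + 1)"
    by (rule ballI)
  from bchoice[OF this] obtain V where V': "\<forall>a\<in>A. (\<forall>U\<in>\<U>. openin Z (V a U) \<and> V a U \<subseteq> U \<inter> S a) \<and>
      (\<Union>U\<in>\<U>. V a U) = S a \<and> (\<forall>x\<in>S a. int (card {U\<in>\<U>. x \<in> V a U}) \<le> n + 1)" ..
  note V = bspec[OF V']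
  define W where "W U = (\<Union>a\<in>A. V a U)" for U
  have "\<forall>U\<in>\<U>. openin Z (W U) \<and> W U \<subseteq> U"
    unfolding W_def using V by (intro ballI conjI openin_Union UN_least) auto
  moreover have "(\<Union>U\<in>\<U>. W U) = topspace Z"
  proof -
    have "(\<Union>U\<in>\<U>. W U) = (\<Union>a\<in>A. \<Union>U\<in>\<U>. V a U)" by (auto simp: W_def)
    also have "\<dots> = (\<Union>a\<in>A. S a)" using V by simp
    finally show ?thesis using S(2) by simp
  qed
  moreover have "int (card {U\<in>\<U>. x \<in> W U}) \<le> n + 1" if x: "x \<in> topspace Z" for x
  proof -
    obtain a where a: "a \<in> A" "x \<in> S a" using x S(2) by blast
    have "x \<in> W U \<longleftrightarrow> x \<in> V a U" if U: "U \<in> \<U>" for U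
    proof
      assume "x \<in> W U"
      then obtain b where b: "b \<in> A" "x \<in> V b U" unfolding W_def by blast
      then have "x \<in> S b" using V U by blast
      then have "b = a" using S(3) a b(1) unfolding disjoint_family_on_def by blast
      then show "x \<in> V a U" using b(2) by simp
    qed (use a(1) in \<open>auto simp: W_def\<close>)
    then have "{U\<in>\<U>. x \<in> W U} = {U\<in>\<U>. x \<in> V a U}" by blast
    then show ?thesis using V a by simp
  qed
  ultimately show "\<exists>V. (\<forall>U\<in>\<U>. openin Z (V U) \<and> V U \<subseteq> U) \<and> (\<Union>U\<in>\<U>. V U) = topspace Z \<and>
      (\<forall>x\<in>topspace Z. int (card {U\<in>\<U>. x \<in> V U}) \<le> n + 1)"
    by (intro exI[of _ W] conjI ballI) simp_all
qed

section \<open>Shrinking and swelling of finite families in normal spaces\<close>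

lemma normal_space_interpolate:
  assumes "normal_space Z" "closedin Z S" "openin Z U" "S \<subseteq> U"
  shows "\<exists>V. openin Z V \<and> S \<subseteq> V \<and> Z closure_of V \<subseteq> U"
  using assms by (simp add: normal_space_alt)

text \<open>The members are shrunk one at a time; \<open>J\<close> collects the indices already
  treated, and the family remains an open cover throughout.\<close>

lemma normal_space_shrinking:
  assumes Z: "normal_space Z" and I: "finite I"
    and U': "\<forall>i\<in>I. openin Z (U i)" "(\<Union>i\<in>I. U i) = topspace Z"
  shows "\<exists>W. (\<forall>i\<in>I. openin Z (W i)) \<and>
    (\<forall>i\<in>I. Z closure_of (W i) \<subseteq> U i) \<and>
    (\<Union>i\<in>I. W i) = topspace Z"
proof -
  note U = U'[rule_format]
  have "\<exists>W. (\<forall>i\<in>I. openin Z (W i)) \<and> (\<forall>i\<in>J. Z closure_of (W i) \<subseteq> U i) \<and>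
      (\<forall>i\<in>I - J. W i = U i) \<and> (\<Union>i\<in>I. W i) = topspace Z" if "finite J" "J \<subseteq> I" for J
    using that
  proof (induction J rule: finite_induct)
    case empty
    then show ?case using U by (intro exI[of _ U]) auto
  next
    case (insert j J)
    then obtain W where W': "\<forall>i\<in>I. openin Z (W i)" "\<forall>i\<in>J. Z closure_of (W i) \<subseteq> U i"
      "\<forall>i\<in>I - J. W i = U i" "(\<Union>i\<in>I. W i) = topspace Z" by auto
    note W = W'[rule_format]
    \<comment> \<open>\<open>?F\<close> is the set of points covered by no other member. Any open
      set around it can replace \<open>W j\<close> without losing the covering property.\<close>
    let ?F = "topspace Z - (\<Union>i\<in>I - {j}. W i)"
    have F: "closedin Z ?F" using W(1) by (intro closedin_diff closedin_topspace) auto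
    have j: "j \<in> I" "W j = U j" using insert W(3) by auto
    have "?F \<subseteq> U j" using W(4) j by auto
    from normal_space_interpolate[OF Z F U(1)[OF j(1)] this]
    obtain V where V: "openin Z V" "?F \<subseteq> V" "Z closure_of V \<subseteq> U j" by (elim exE conjE)
    have sub: "W i \<subseteq> topspace Z" if "i \<in> I" for i using W(1)[OF that] openin_subset by blast
    have "(\<Union>i\<in>I. (W(j := V)) i) = topspace Z"
      using V(2) sub j(1) openin_subset[OF V(1)] by auto
    then show ?case
      using V(1,3) W insert.hyps insert.prems by (intro exI[of _ "W(j := V)"]) auto
  qed
  from this[OF I order_refl] obtain W where "\<forall>i\<in>I. openin Z (W i)" "\<forall>i\<in>I. Z closure_of (W i) \<subseteq> U i"
    "(\<Union>i\<in>I. W i) = topspace Z"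
    by (elim exE conjE)
  then show ?thesis by (intro exI[of _ W] conjI)
qed

text \<open>The closed sets are enlarged to closed neighbourhoods one index at a time. The new
  neighbourhood avoids the closed set \<open>H\<close> of points that already lie in
  \<open>n + 1\<close> of the other sets, so the multiplicity never exceeds
  \<open>n + 1\<close>.\<close>

lemma normal_space_swelling:
  assumes Z: "normal_space Z" and I: "finite I"
    and F': "\<forall>i\<in>I. closedin Z (F i)"
    and U': "\<forall>i\<in>I. openin Z (U i)" "\<forall>i\<in>I. F i \<subseteq> U i"
    and ord': "\<forall>x\<in>topspace Z. int (card {i\<in>I. x \<in> F i}) \<le> n + 1"
  shows "\<exists>W. (\<forall>i\<in>I. openin Z (W i)) \<and>
    (\<forall>i\<in>I. F i \<subseteq> W i) \<and>
    (\<forall>i\<in>I. W i \<subseteq> U i) \<and>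
    (\<forall>x\<in>topspace Z. int (card {i\<in>I. x \<in> W i}) \<le> n + 1)"
proof -
  note U = U'[rule_format] and F = F'[rule_format] and ord = ord'[rule_format]
  \<comment> \<open>For indices in \<open>J\<close> an open set has been inserted between
    \<open>F i\<close> and \<open>G i\<close>; the remaining sets are still the original
    ones.\<close>
  have "\<exists>G. (\<forall>i\<in>I. closedin Z (G i) \<and> F i \<subseteq> G i \<and> G i \<subseteq> U i) \<and>
      (\<forall>i\<in>J. \<exists>W. openin Z W \<and> F i \<subseteq> W \<and> W \<subseteq> G i) \<and> (\<forall>i\<in>I - J. G i = F i) \<and>
      (\<forall>x\<in>topspace Z. int (card {i\<in>I. x \<in> G i}) \<le> n + 1)" if "finite J" "J \<subseteq> I" for J
    using that
  proof (induction J rule: finite_induct)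
    case empty
    then show ?case using F U ord by (intro exI[of _ F]) auto
  next
    case (insert j J)
    then obtain G where G': "\<forall>i\<in>I. closedin Z (G i) \<and> F i \<subseteq> G i \<and> G i \<subseteq> U i"
      "\<forall>i\<in>J. \<exists>W. openin Z W \<and> F i \<subseteq> W \<and> W \<subseteq> G i" "\<forall>i\<in>I - J. G i = F i"
      "\<forall>x\<in>topspace Z. int (card {i\<in>I. x \<in> G i}) \<le> n + 1" by auto
    note G = G'[rule_format]
    have j: "j \<in> I" "j \<notin> J" using insert by auto
    define \<K> where "\<K> = {K. K \<subseteq> I - {j} \<and> int (card K) = n + 1}"
    \<comment> \<open>The factor \<open>topspace Z\<close> gives the intersection its correct value
      for empty \<open>K\<close>, which occurs when \<open>n = -1\<close>.\<close>
    define H where "H = (\<Union>K\<in>\<K>. topspace Z \<inter> (\<Inter>i\<in>K. G i))"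
    have "finite \<K>" unfolding \<K>_def using I by (auto intro: rev_finite_subset[of "Pow I"])
    moreover have "closedin Z (topspace Z \<inter> (\<Inter>i\<in>K. G i))" if "K \<in> \<K>" for K
    proof -
      have "topspace Z \<inter> (\<Inter>i\<in>K. G i) = \<Inter>(insert (topspace Z) (G ` K))" by auto
      also have "closedin Z \<dots>" using G(1) that by (intro closedin_Inter) (auto simp: \<K>_def)
      finally show ?thesis .
    qed
    ultimately have H: "closedin Z H"
      unfolding H_def by (intro closedin_Union) auto
    have finI: "finite {i\<in>I. P i}" for P using I by simp
    have FH: "F j \<inter> H = {}"
    proof (rule equals0I)
      fix x assume "x \<in> F j \<inter> H"
      then obtain K where K: "K \<in> \<K>" "x \<in> topspace Z" "\<And>i. i \<in> K \<Longrightarrow> x \<in> G i" "x \<in> F j" by (auto simp: H_def)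
      have "finite K" using K(1) I finite_subset by (auto simp: \<K>_def)
      have "card (insert j K) \<le> card {i\<in>I. x \<in> G i}"
        using K j G(1)[of j] I by (intro card_mono) (auto simp: \<K>_def)
      moreover have "card (insert j K) = Suc (card K)"
        using K(1) \<open>finite K\<close> by (subst card_insert_disjoint) (auto simp: \<K>_def)
      ultimately show False using G(4)[OF K(2)] K(1) by (auto simp: \<K>_def)
    qed
    have "openin Z (U j - H)" using U(1)[OF j(1)] H by (rule openin_diff)
    moreover have "F j \<subseteq> U j - H" using FH U(2)[OF j(1)] by blast
    ultimately have "\<exists>W. openin Z W \<and> F j \<subseteq> W \<and> Z closure_of W \<subseteq> U j - H"
      by (rule normal_space_interpolate[OF Z F[OF j(1)]])
    then obtain W where W: "openin Z W" "F j \<subseteq> W" "Z closure_of W \<subseteq> U j - H" by (elim exE conjE)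
    have WC: "W \<subseteq> Z closure_of W" using W(1) by (intro closure_of_subset openin_subset)
    have "\<forall>x\<in>topspace Z. int (card {i\<in>I. x \<in> (G(j := Z closure_of W)) i}) \<le> n + 1"
    proof (intro ballI, rule ccontr)
      fix x assume x: "x \<in> topspace Z"
      assume neg: "\<not> int (card {i\<in>I. x \<in> (G(j := Z closure_of W)) i}) \<le> n + 1"
      let ?L = "{i \<in> I - {j}. x \<in> G i}"
      have sub: "{i\<in>I. x \<in> (G(j := Z closure_of W)) i} \<subseteq> insert j ?L" by auto
      have finL: "finite ?L" using I by simp
      have "card {i\<in>I. x \<in> (G(j := Z closure_of W)) i} \<le> card (insert j ?L)"
        using sub finL by (intro card_mono) auto
      also have "\<dots> = Suc (card ?L)" using finL by (subst card_insert_disjoint) auto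
      finally have "n + 1 \<le> int (card ?L)" using neg by simp
      then have "nat (n + 1) \<le> card ?L" by linarith
      then obtain K where K: "K \<subseteq> ?L" "card K = nat (n + 1)"
        by (rule obtain_subset_with_card_n)
      \<comment> \<open>The multiplicity bound at the point \<open>x\<close> forces
        \<open>n \<ge> -1\<close>, so \<open>nat (n + 1)\<close> is not truncated.\<close>
      have "0 \<le> n + 1" using ord[OF x] by linarith
      then have "K \<in> \<K>" using K by (auto simp: \<K>_def)
      then have "x \<in> H" using K(1) x by (auto simp: H_def)
      then have "x \<notin> Z closure_of W" using W(3) by blast
      then have "{i\<in>I. x \<in> (G(j := Z closure_of W)) i} \<subseteq> {i\<in>I. x \<in> G i}" by auto
      then have "card {i\<in>I. x \<in> (G(j := Z closure_of W)) i} \<le> card {i\<in>I. x \<in> G i}"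
        by (intro card_mono finI)
      then show False using G(4)[OF x] neg by linarith
    qed
    moreover have "\<forall>i\<in>I. closedin Z ((G(j := Z closure_of W)) i) \<and> F i \<subseteq> (G(j := Z closure_of W)) i \<and>
        (G(j := Z closure_of W)) i \<subseteq> U i"
      using G(1) W WC by auto
    moreover have "\<forall>i\<in>insert j J. \<exists>V. openin Z V \<and> F i \<subseteq> V \<and> V \<subseteq> (G(j := Z closure_of W)) i"
      using G(2) W WC j by auto
    moreover have "\<forall>i\<in>I - insert j J. (G(j := Z closure_of W)) i = F i"
      using G(3) by auto
    ultimately show ?case by (intro exI[of _ "G(j := Z closure_of W)"] conjI)
  qed
  from this[OF I order_refl] obtain G where G': "\<forall>i\<in>I. closedin Z (G i) \<and> F i \<subseteq> G i \<and> G i \<subseteq> U i"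
      "\<forall>i\<in>I. \<exists>W. openin Z W \<and> F i \<subseteq> W \<and> W \<subseteq> G i"
      "\<forall>x\<in>topspace Z. int (card {i\<in>I. x \<in> G i}) \<le> n + 1"
    by (elim exE conjE)
  note G = G'[rule_format]
  from bchoice[OF G'(2)] obtain W where W: "\<forall>i\<in>I. openin Z (W i) \<and> F i \<subseteq> W i \<and> W i \<subseteq> G i" ..
  show ?thesis
  proof (intro exI[of _ W] conjI ballI)
    fix x assume x: "x \<in> topspace Z"
    have "card {i\<in>I. x \<in> W i} \<le> card {i\<in>I. x \<in> G i}"
      using W I by (intro card_mono) auto
    then show "int (card {i\<in>I. x \<in> W i}) \<le> n + 1" using G(3)[OF x] by linarith
  qed (use G(1) W in blast)+
qed

section \<open>The sum theorem for countably many closed sets\<close>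

text \<open>One step of the countable sum theorem: the multiplicity is corrected on \<open>A\<close>
  alone. It is the closures that are bounded, so that the bound is inherited by every later
  refinement and by the intersection of their closures.\<close>

lemma refine_cover_on_closed:
  assumes Z: "normal_space Z" and A: "closedin Z A" and dim: "covering_dim_le (subtopology Z A) n"
    and I: "finite I" and U': "\<forall>i\<in>I. openin Z (U i)" "(\<Union>i\<in>I. U i) = topspace Z"
  shows "\<exists>W. (\<forall>i\<in>I. openin Z (W i)) \<and>
    (\<forall>i\<in>I. Z closure_of (W i) \<subseteq> U i) \<and>
    (\<Union>i\<in>I. W i) = topspace Z \<and>
    (\<forall>x\<in>A. int (card {i\<in>I. x \<in> Z closure_of (W i)}) \<le> n + 1)"
proof -
  note U = U'[rule_format]
  let ?A = "subtopology Z A"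
  have topA: "topspace ?A = A" "A \<subseteq> topspace Z"
    using closedin_subset[OF A] by (auto simp: Int_absorb1)
  have 1: "\<forall>i\<in>I. openin ?A (U i \<inter> A)"
    using U(1) by (simp add: openin_subtopology_Int)
  have 2: "(\<Union>i\<in>I. U i \<inter> A) = topspace ?A" using U(2) topA by auto
  from covering_dim_le_family[OF dim I 1 2] obtain V where V': "\<forall>i\<in>I. openin ?A (V i)" "\<forall>i\<in>I. V i \<subseteq> U i \<inter> A"
      "(\<Union>i\<in>I. V i) = topspace ?A" "\<forall>x\<in>topspace ?A. int (card {i\<in>I. x \<in> V i}) \<le> n + 1"
    by (elim exE conjE)
  note V = V'[rule_format]
  \<comment> \<open>\<open>T i\<close> agrees with \<open>V i\<close> on \<open>A\<close> and with
    \<open>U i\<close> off \<open>A\<close>. It is open because \<open>A - V i\<close> is closed in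
    \<open>A\<close>, hence in \<open>Z\<close>.\<close>
  define T where "T i = U i - (A - V i)" for i
  have T1: "openin Z (T i)" if "i \<in> I" for i
  proof -
    have "closedin ?A (topspace ?A - V i)" using V(1)[OF that] by blast
    then have "closedin Z (A - V i)" using A closedin_trans_full topA by metis
    then show ?thesis unfolding T_def using U(1)[OF that] by (rule openin_diff[rotated])
  qed
  have T2: "(\<Union>i\<in>I. T i) = topspace Z"
  proof
    show "(\<Union>i\<in>I. T i) \<subseteq> topspace Z" using T1 openin_subset by blast
    show "topspace Z \<subseteq> (\<Union>i\<in>I. T i)"
    proof
      fix x assume x: "x \<in> topspace Z"
      show "x \<in> (\<Union>i\<in>I. T i)"
      proof (cases "x \<in> A")
        case True
        then obtain i where "i \<in> I" "x \<in> V i" using V(3) topA by blast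
        then show ?thesis using V(2) by (auto simp: T_def)
      next
        case False
        then show ?thesis using x U(2) by (auto simp: T_def)
      qed
    qed
  qed
  have T1': "\<forall>i\<in>I. openin Z (T i)" using T1 by blast
  from normal_space_shrinking[OF Z I T1' T2] obtain W where W': "\<forall>i\<in>I. openin Z (W i)" "\<forall>i\<in>I. Z closure_of (W i) \<subseteq> T i"
    "(\<Union>i\<in>I. W i) = topspace Z"
    by (elim exE conjE)
  note W = W'[rule_format]
  show ?thesis
  proof (intro exI[of _ W] conjI ballI)
    fix x assume x: "x \<in> A"
    have "card {i\<in>I. x \<in> Z closure_of (W i)} \<le> card {i\<in>I. x \<in> V i}"
      using W(2) x I by (intro card_mono) (auto simp: T_def)
    then show "int (card {i\<in>I. x \<in> Z closure_of (W i)}) \<le> n + 1" using V(4) x topA by fastforce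
  qed (use W in \<open>auto simp: T_def\<close>)
qed

text \<open>The cover is refined successively on \<open>B 0\<close>, \<open>B 1\<close>, and so on,
  each closure lying in the previous member. The intersections \<open>F U\<close> are closed and
  have multiplicity at most \<open>n + 1\<close> everywhere, since each point lies in some
  \<open>B t\<close>. Swelling them restores openness.\<close>

theorem covering_dim_le_countable_closed_Union:
  fixes B :: "nat \<Rightarrow> 'a set"
  assumes Z: "normal_space Z" and B: "\<And>t. closedin Z (B t)" "(\<Union>t. B t) = topspace Z"
    and dim: "\<And>t. covering_dim_le (subtopology Z (B t)) n"
  shows "covering_dim_le Z n"
proof (rule covering_dim_leI)
  fix \<U> assume \<U>: "finite \<U>" "open_cover Z \<U>"
  define P where "P W \<longleftrightarrow> (\<forall>U\<in>\<U>. openin Z (W U)) \<and> (\<Union>U\<in>\<U>. W U) = topspace Z" for W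
  define Q where "Q t W W' \<longleftrightarrow> (\<forall>U\<in>\<U>. Z closure_of (W' U) \<subseteq> W U) \<and>
      (\<forall>x\<in>B t. int (card {U\<in>\<U>. x \<in> Z closure_of (W' U)}) \<le> n + 1)" for t and W W' :: "'a set \<Rightarrow> 'a set"
  have refine: "\<exists>W'. P W' \<and> Q t W W'" if "P W" for t W
  proof -
    have W: "\<forall>U\<in>\<U>. openin Z (W U)" using \<open>P W\<close> by (simp add: P_def)
    have cov: "(\<Union>U\<in>\<U>. W U) = topspace Z" using \<open>P W\<close> by (simp add: P_def)
    from refine_cover_on_closed[OF Z B(1)[of t] dim[of t] \<U>(1) W cov] obtain W' where "\<forall>U\<in>\<U>. openin Z (W' U)" "\<forall>U\<in>\<U>. Z closure_of (W' U) \<subseteq> W U"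
      "(\<Union>U\<in>\<U>. W' U) = topspace Z"
      "\<forall>x\<in>B t. int (card {U\<in>\<U>. x \<in> Z closure_of (W' U)}) \<le> n + 1"
      by (elim exE conjE)
    then have "P W' \<and> Q t W W'" by (simp add: P_def Q_def)
    then show ?thesis by (intro exI[of _ W'])
  qed
  \<comment> \<open>The clause for \<open>t = 0\<close> starts the chain at the given cover.\<close>
  have "\<exists>W. \<forall>t. (P (W t) \<and> (t = 0 \<longrightarrow> W t = id)) \<and> Q t (W t) (W (Suc t))"
  proof (rule dependent_nat_choice)
    show "\<exists>W. P W \<and> ((0::nat) = 0 \<longrightarrow> W = id)"
      using \<U>(2) by (intro exI[of _ id]) (simp add: P_def open_cover_def)
    show "\<exists>W'. (P W' \<and> (Suc t = 0 \<longrightarrow> W' = id)) \<and> Q t W W'" if "P W \<and> (t = 0 \<longrightarrow> W = id)" for W t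
      using refine[of W t] that by simp
  qed
  then obtain W where "\<forall>t. (P (W t) \<and> (t = 0 \<longrightarrow> W t = id)) \<and> Q t (W t) (W (Suc t))" ..
  then have W0: "W 0 = id" and W: "\<And>t. P (W t)" "\<And>t. Q t (W t) (W (Suc t))" by simp_all
  define F where "F U = (\<Inter>t. Z closure_of (W (Suc t) U))" for U
  have step: "W (Suc t) U \<subseteq> Z closure_of (W (Suc t) U)" "Z closure_of (W (Suc t) U) \<subseteq> W t U"
    if "U \<in> \<U>" for t U
  proof -
    have "openin Z (W (Suc t) U)" using W(1)[of "Suc t"] that by (simp add: P_def)
    then show "W (Suc t) U \<subseteq> Z closure_of (W (Suc t) U)" by (intro closure_of_subset openin_subset)
    show "Z closure_of (W (Suc t) U) \<subseteq> W t U" using W(2)[of t] that by (simp add: Q_def)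
  qed
  have anti: "W t U \<subseteq> W s U" if "s \<le> t" "U \<in> \<U>" for s t U
    using that(1)
  proof (rule lift_Suc_antimono_le[rotated])
    fix t show "W (Suc t) U \<subseteq> W t U" using step[OF that(2), of t] by blast
  qed
  have F: "\<forall>U\<in>\<U>. closedin Z (F U)" unfolding F_def by (intro ballI closedin_Inter) auto
  have FU: "\<forall>U\<in>\<U>. F U \<subseteq> U" using step(2)[of _ 0] W0 by (auto simp: F_def)
  have ord: "int (card {U\<in>\<U>. x \<in> F U}) \<le> n + 1" if x: "x \<in> topspace Z" for x
  proof -
    obtain t where t: "x \<in> B t" using B(2) x by blast
    have "card {U\<in>\<U>. x \<in> F U} \<le> card {U\<in>\<U>. x \<in> Z closure_of (W (Suc t) U)}"
      using \<U>(1) by (intro card_mono) (auto simp: F_def)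
    then show ?thesis using W(2)[of t] t unfolding Q_def by fastforce
  qed
  have cov: "\<exists>U\<in>\<U>. x \<in> F U" if x: "x \<in> topspace Z" for x
  proof (rule ccontr)
    assume "\<not> ?thesis"
    then have "\<forall>U\<in>\<U>. \<exists>t. x \<notin> W (Suc t) U" using step(1) by (fastforce simp: F_def)
    then obtain \<tau> where \<tau>: "\<And>U. U \<in> \<U> \<Longrightarrow> x \<notin> W (Suc (\<tau> U)) U" by metis
    \<comment> \<open>There are finitely many members, so a point outside every \<open>F U\<close>
      has left all of them by stage \<open>m\<close>; but stage \<open>m\<close> is still a
      cover.\<close>
    define m where "m = Suc (Max (\<tau> ` \<U>))"
    have "Suc (\<tau> U) \<le> m" if "U \<in> \<U>" for U using that \<U>(1) by (simp add: m_def)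
    then have "x \<notin> W m U" if "U \<in> \<U>" for U using \<tau>[OF that] anti[OF _ that] that by blast
    then show False using W(1)[of m] x unfolding P_def by blast
  qed
  have U: "\<forall>U\<in>\<U>. openin Z U" using \<U>(2) by (simp add: open_cover_def)
  have "\<forall>x\<in>topspace Z. int (card {U\<in>\<U>. x \<in> F U}) \<le> n + 1" using ord by (rule ballI)
  from normal_space_swelling[OF Z \<U>(1) F U FU this] obtain V where V': "\<forall>U\<in>\<U>. openin Z (V U)" "\<forall>U\<in>\<U>. F U \<subseteq> V U" "\<forall>U\<in>\<U>. V U \<subseteq> U"
    "\<forall>x\<in>topspace Z. int (card {U\<in>\<U>. x \<in> V U}) \<le> n + 1"
    by (elim exE conjE)
  note V = V'[rule_format]
  have "(\<Union>U\<in>\<U>. V U) = topspace Z"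
    using V(2,3) cov \<U>(2) by (fastforce simp: open_cover_def)
  then show "\<exists>V. (\<forall>U\<in>\<U>. openin Z (V U) \<and> V U \<subseteq> U) \<and> (\<Union>U\<in>\<U>. V U) = topspace Z \<and>
      (\<forall>x\<in>topspace Z. int (card {U\<in>\<U>. x \<in> V U}) \<le> n + 1)"
    using V by (intro exI[of _ V] conjI ballI) simp_all
qed

section \<open>Covering dimension in metric spaces\<close>

lemma normal_space_top_of_set: "normal_space (top_of_set (S :: 'a::metric_space set))"
  by (intro metrizable_imp_normal_space metrizable_space_subtopology metrizable_space_euclidean)

section \<open>Uniformly separated families\<close>

text \<open>Two points of the union within \<open>e / 2\<close> of \<open>x\<close> belong to the
  same member, so near \<open>x\<close> the union coincides with a single closed set.\<close>

lemma closed_separated_Union: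
  fixes C :: "'i \<Rightarrow> 'a::metric_space set"
  assumes "e > 0" and C: "\<And>a. a \<in> A \<Longrightarrow> closed (C a)"
    and sep: "\<And>a b x y. \<lbrakk>a \<in> A; b \<in> A; a \<noteq> b; x \<in> C a; y \<in> C b\<rbrakk> \<Longrightarrow> e \<le> dist x y"
  shows "closed (\<Union>a\<in>A. C a)"
proof -
  have "x \<in> (\<Union>a\<in>A. C a)" if x: "x \<in> closure (\<Union>a\<in>A. C a)" for x
  proof -
    have "\<exists>y\<in>\<Union>a\<in>A. C a. dist y x < e / 2"
      using x \<open>e > 0\<close> closure_approachable half_gt_zero by blast
    then obtain a y where a: "a \<in> A" "y \<in> C a" "dist y x < e / 2" by blast
    have "x \<in> closure (C a)"
      unfolding closure_approachable
    proof (intro allI impI)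
      fix d :: real assume "d > 0"
      then have "min d (e / 2) > 0" using \<open>e > 0\<close> by simp
      then have "\<exists>z\<in>\<Union>a\<in>A. C a. dist z x < min d (e / 2)"
        using x closure_approachable by blast
      then obtain b z where b: "b \<in> A" "z \<in> C b" "dist z x < min d (e / 2)" by blast
      have "dist y z < e" using a(3) b(3) dist_triangle_half_l[of y x e z] by (simp add: dist_commute)
      then have "b = a" using sep[OF a(1) b(1) _ a(2) b(2)] by fastforce
      then show "\<exists>y\<in>C a. dist y x < d" using b by auto
    qed
    then show ?thesis using C[OF a(1)] a(1) by auto
  qed
  then show ?thesis using closure_subset_eq by blast
qed

text \<open>The open \<open>e\<close>-neighbourhood of a member meets no other member, so every
  member is open in the union.\<close>

lemma covering_dim_le_separated_Union:
  fixes C :: "'i \<Rightarrow> 'a::metric_space set"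
  assumes "e > 0" and sep: "\<And>a b x y. \<lbrakk>a \<in> A; b \<in> A; a \<noteq> b; x \<in> C a; y \<in> C b\<rbrakk> \<Longrightarrow> e \<le> dist x y"
    and dim: "\<And>a. a \<in> A \<Longrightarrow> covering_dim_le (top_of_set (C a)) n"
  shows "covering_dim_le (top_of_set (\<Union>a\<in>A. C a)) n"
proof (rule covering_dim_le_disjoint_open_Union)
  let ?U = "\<Union>a\<in>A. C a"
  show "openin (top_of_set ?U) (C a)" if a: "a \<in> A" for a
  proof -
    have "?U \<inter> (\<Union>x\<in>C a. ball x e) = C a"
      using sep a \<open>e > 0\<close> by fastforce
    moreover have "openin (top_of_set ?U) (?U \<inter> (\<Union>x\<in>C a. ball x e))"
      by (intro openin_open_Int open_UN ballI open_ball)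
    ultimately show ?thesis by simp
  qed
  show "disjoint_family_on C A"
    using sep \<open>e > 0\<close> by (fastforce simp: disjoint_family_on_def)
  show "covering_dim_le (subtopology (top_of_set ?U) (C a)) n" if a: "a \<in> A" for a
  proof -
    have "?U \<inter> C a = C a" using a by blast
    then show ?thesis using dim[OF a] by (simp add: subtopology_subtopology)
  qed
qed simp

section \<open>Sets covered by countably many closed sets of bounded dimension\<close>

text \<open>The set \<open>A\<close> is only covered by the closed sets, so the property passes to
  arbitrary subsets. The closed sets stay inside \<open>S\<close>, so for \<open>A = S\<close> they
  exhaust \<open>S\<close> and the countable sum theorem applies.\<close>

definition sigma_dim_le :: "'a::topological_space set \<Rightarrow> int \<Rightarrow> 'a set \<Rightarrow> bool" where
  "sigma_dim_le S n A \<longleftrightarrow>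
     (\<exists>\<B>. countable \<B> \<and> (\<forall>B\<in>\<B>. closed B \<and> B \<subseteq> S \<and> covering_dim_le (top_of_set B) n) \<and> A \<subseteq> \<Union>\<B>)"

lemma sigma_dim_le_mono: "sigma_dim_le S n A \<Longrightarrow> A' \<subseteq> A \<Longrightarrow> sigma_dim_le S n A'"
  unfolding sigma_dim_le_def by (meson order_trans)

lemma sigma_dim_le_closed:
  "\<lbrakk>closed B; B \<subseteq> S; covering_dim_le (top_of_set B) n; A \<subseteq> B\<rbrakk> \<Longrightarrow> sigma_dim_le S n A"
  unfolding sigma_dim_le_def by (intro exI[of _ "{B}"]) simp

lemma sigma_dim_le_UN:
  assumes I: "countable I" and A: "\<And>i. i \<in> I \<Longrightarrow> sigma_dim_le S n (A i)"
  shows "sigma_dim_le S n (\<Union>i\<in>I. A i)"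
proof -
  have "\<forall>i\<in>I. \<exists>\<B>. countable \<B> \<and> (\<forall>B\<in>\<B>. closed B \<and> B \<subseteq> S \<and> covering_dim_le (top_of_set B) n) \<and> A i \<subseteq> \<Union>\<B>"
    using A by (simp add: sigma_dim_le_def)
  from bchoice[OF this] obtain \<B> where \<B>: "\<forall>i\<in>I. countable (\<B> i) \<and>
      (\<forall>B\<in>\<B> i. closed B \<and> B \<subseteq> S \<and> covering_dim_le (top_of_set B) n) \<and> A i \<subseteq> \<Union>(\<B> i)" ..
  have "countable (\<Union>i\<in>I. \<B> i)" using I \<B> by simp
  moreover have "A i \<subseteq> \<Union>(\<Union>i\<in>I. \<B> i)" if "i \<in> I" for i
  proof -
    have "A i \<subseteq> \<Union>(\<B> i)" using \<B> that by simp
    also have "\<dots> \<subseteq> \<Union>(\<Union>i\<in>I. \<B> i)" using that by blast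
    finally show ?thesis .
  qed
  then have "(\<Union>i\<in>I. A i) \<subseteq> \<Union>(\<Union>i\<in>I. \<B> i)" by (rule UN_least)
  ultimately show ?thesis
    unfolding sigma_dim_le_def using \<B> by (intro exI[of _ "\<Union>i\<in>I. \<B> i"]) simp
qed

lemma sigma_dim_le_imp_covering_dim_le:
  fixes S :: "'a::metric_space set"
  assumes "S \<noteq> {}" and "sigma_dim_le S n S"
  shows "covering_dim_le (top_of_set S) n"
proof -
  from assms(2) obtain \<B> where \<B>': "countable \<B>"
      "\<forall>B\<in>\<B>. closed B \<and> B \<subseteq> S \<and> covering_dim_le (top_of_set B) n" "S \<subseteq> \<Union>\<B>"
    unfolding sigma_dim_le_def by (elim exE conjE)
  note \<B> = \<B>'(1) bspec[OF \<B>'(2)] \<B>'(3)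
  have ne: "\<B> \<noteq> {}" using assms(1) \<B>(3) by blast
  define B where "B = from_nat_into \<B>"
  have B: "closed (B t)" "B t \<subseteq> S" "covering_dim_le (top_of_set (B t)) n" for t
    using \<B>(2) from_nat_into[OF ne] by (auto simp: B_def)
  show ?thesis
  proof (rule covering_dim_le_countable_closed_Union[OF normal_space_top_of_set])
    show "closedin (top_of_set S) (B t)" for t
      using B(1,2) closed_subset by blast
    have "(\<Union>t. B t) = \<Union>\<B>" using range_from_nat_into[OF ne \<B>(1)] by (simp add: B_def)
    then show "(\<Union>t. B t) = topspace (top_of_set S)" using \<B>(2,3) by auto
    show "covering_dim_le (subtopology (top_of_set S) (B t)) n" for t
      using B(2,3)[of t] by (simp add: subtopology_subtopology Int_absorb1)
  qed
qed

text \<open>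
  Well-ordering the points of \<open>A\<close> and cutting each ball of radius \<open>\<delta>\<close> down to the points that
  lie \<open>1/(t+1)\<close>-deep inside it and in no earlier ball yields, for fixed \<open>t\<close>, a uniformly
  separated family; this is the construction in Stone's theorem that metric spaces are paracompact.
\<close>

lemma sigma_dim_le_uniformly_local:
  fixes A :: "'a::metric_space set"
  assumes loc: "\<And>x. x \<in> A \<Longrightarrow> sigma_dim_le S n (A \<inter> ball x \<delta>)" and "\<delta> > 0"
  shows "sigma_dim_le S n A"
proof -
  obtain r where r: "well_order_on A r" using well_order_on by blast
  have tot: "(a, b) \<in> r \<or> (b, a) \<in> r" if "a \<in> A" "b \<in> A" "a \<noteq> b" for a b
    using r that by (auto simp: well_order_on_def linear_order_on_def total_on_def)
  have wf: "wf (r - Id)" using r by (simp add: well_order_on_def)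
  have "\<forall>a\<in>A. \<exists>\<B>. countable \<B> \<and> (\<forall>B\<in>\<B>. closed B \<and> B \<subseteq> S \<and> covering_dim_le (top_of_set B) n) \<and>
      A \<inter> ball a \<delta> \<subseteq> \<Union>\<B>"
    using loc by (simp add: sigma_dim_le_def)
  from bchoice[OF this] obtain \<B> where \<B>': "\<forall>a\<in>A. countable (\<B> a) \<and>
      (\<forall>B\<in>\<B> a. closed B \<and> B \<subseteq> S \<and> covering_dim_le (top_of_set B) n) \<and> A \<inter> ball a \<delta> \<subseteq> \<Union>(\<B> a)" ..
  then have \<B>: "countable (\<B> a)" "A \<inter> ball a \<delta> \<subseteq> \<Union>(\<B> a)"
      "B \<in> \<B> a \<Longrightarrow> closed B \<and> B \<subseteq> S \<and> covering_dim_le (top_of_set B) n" if "a \<in> A" for a B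
    using that by simp_all
  have ne: "\<B> a \<noteq> {}" if "a \<in> A" for a
  proof -
    have "a \<in> A \<inter> ball a \<delta>" using that \<open>\<delta> > 0\<close> by simp
    then show ?thesis using \<B>(2)[OF that] by blast
  qed
  define B where "B a i = from_nat_into (\<B> a) i" for a and i :: nat
  have B: "closed (B a i)" "B a i \<subseteq> S" "covering_dim_le (top_of_set (B a i)) n" if "a \<in> A" for a i
    using \<B>(3)[OF that from_nat_into[OF ne[OF that]]] by (simp_all add: B_def)
  define P where "P a t = {x \<in> A. dist x a \<le> \<delta> - 1 / real (Suc t) \<and>
      (\<forall>b\<in>A. (b, a) \<in> r \<longrightarrow> b \<noteq> a \<longrightarrow> \<delta> \<le> dist x b)}" for a t
  have sep_P: "1 / real (Suc t) \<le> dist x y"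
    if ab: "a \<in> A" "b \<in> A" "a \<noteq> b" "x \<in> P a t" "y \<in> P b t" for a b x y t
  proof -
    have *: "1 / real (Suc t) \<le> dist x y"
      if "a \<in> A" "a \<noteq> b" "x \<in> P a t" "y \<in> P b t" "(a, b) \<in> r" for a b x y
    proof -
      have "dist x a \<le> \<delta> - 1 / real (Suc t)" "\<delta> \<le> dist y a" using that by (auto simp: P_def)
      moreover have "dist y a \<le> dist x y + dist x a" by (metis dist_commute dist_triangle)
      ultimately show ?thesis by linarith
    qed
    show ?thesis using tot[OF ab(1-3)] *[of a b x y] *[of b a y x] ab by (auto simp: dist_commute)
  qed
  have sep: "1 / real (Suc t) \<le> dist x y"
    if ab: "a \<in> A" "b \<in> A" "a \<noteq> b" "x \<in> closure (P a t)" "y \<in> closure (P b t)" for a b x y t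
  proof -
    have "P a t \<noteq> {}" "P b t \<noteq> {}" using ab by auto
    \<comment> \<open>The distance between two sets does not change when they are closed, so the
      closures inherit the separation.\<close>
    then have "1 / real (Suc t) \<le> setdist (P a t) (P b t)" using sep_P[OF ab(1-3)] by (rule le_setdistI)
    also have "\<dots> = setdist (closure (P a t)) (closure (P b t))" by simp
    also have "\<dots> \<le> dist x y" using ab by (intro setdist_le_dist)
    finally show ?thesis .
  qed
  \<comment> \<open>One piece is taken from each ball, the \<open>i\<close>-th one. For fixed
    \<open>t\<close> and \<open>i\<close> these pieces are uniformly separated over the centres
    \<open>a\<close>, so only countably many unions arise.\<close>
  define T where "T t i = (\<Union>a\<in>A. B a i \<inter> closure (P a t))" for t i
  have T: "closed (T t i) \<and> T t i \<subseteq> S \<and> covering_dim_le (top_of_set (T t i)) n" for t i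
  proof (intro conjI)
    have pos: "0 < 1 / real (Suc t)" by simp
    show "closed (T t i)"
      unfolding T_def
    proof (rule closed_separated_Union[OF pos])
      show "closed (B a i \<inter> closure (P a t))" if "a \<in> A" for a using B(1)[OF that] by blast
    qed (use sep in blast)
    show "T t i \<subseteq> S" using B(2) by (auto simp: T_def)
    show "covering_dim_le (top_of_set (T t i)) n"
      unfolding T_def
    proof (rule covering_dim_le_separated_Union[OF pos])
      show "covering_dim_le (top_of_set (B a i \<inter> closure (P a t))) n" if "a \<in> A" for a
      proof -
        have "closedin (top_of_set (B a i)) (B a i \<inter> closure (P a t))" by (intro closedin_closed_Int closed_closure)
        from covering_dim_le_closed_subtopology[OF B(3)[OF that] this] show ?thesis
          by (simp add: subtopology_subtopology)
      qed
    qed (use sep in blast)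
  qed
  have "A \<subseteq> (\<Union>t. \<Union>i. T t i)"
  proof
    fix x assume x: "x \<in> A"
    define Q where "Q = {a \<in> A. dist x a < \<delta>}"
    have "x \<in> Q" using x \<open>\<delta> > 0\<close> by (simp add: Q_def)
    \<comment> \<open>The least centre whose ball contains \<open>x\<close>: no earlier ball
      contains \<open>x\<close>, and \<open>x\<close> lies \<open>1 / real (Suc t)\<close>-deep in
      this one for some \<open>t\<close>.\<close>
    then obtain a where a: "a \<in> Q" "\<And>b. (b, a) \<in> r - Id \<Longrightarrow> b \<notin> Q"
      using wfE_min[OF wf] by metis
    then have aA: "a \<in> A" "dist x a < \<delta>" by (simp_all add: Q_def)
    obtain t where t: "1 / real (Suc t) < \<delta> - dist x a"
      using reals_Archimedean[of "\<delta> - dist x a"] aA by (auto simp: inverse_eq_divide)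
    have "x \<in> P a t"
      using x t a(2) by (fastforce simp: P_def Q_def)
    then have "x \<in> closure (P a t)" using closure_subset by blast
    moreover have "x \<in> \<Union>(\<B> a)" using \<B>(2)[OF aA(1)] x aA(2) by (auto simp: dist_commute)
    then have "\<exists>i. x \<in> B a i"
      using range_from_nat_into[OF ne[OF aA(1)] \<B>(1)[OF aA(1)]] unfolding B_def by (metis UnionE imageE)
    ultimately show "x \<in> (\<Union>t. \<Union>i. T t i)" using aA(1) by (auto simp: T_def)
  qed
  moreover have "sigma_dim_le S n (\<Union>t. \<Union>i. T t i)"
    using T by (intro sigma_dim_le_UN sigma_dim_le_closed[where B = "T _ _"]) auto
  ultimately show ?thesis by (rule sigma_dim_le_mono[rotated])
qed

section \<open>Closures of bi-Lipschitz correspondences\<close>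

text \<open>The expansion estimate is a closed condition on pairs and extends to the closure of
  \<open>R\<close>. There it makes \<open>h\<close> injective with Lipschitz inverse. Preimages of a
  convergent sequence form a Cauchy sequence, so completeness of the domain makes the image
  closed.\<close>

lemma closure_image_expanding:
  fixes h :: "'c::complete_space \<Rightarrow> 'a::metric_space"
  assumes h: "continuous_on UNIV h"
    and expand: "\<And>p q. \<lbrakk>p \<in> R; q \<in> R\<rbrakk> \<Longrightarrow> dist p q \<le> L * dist (h p) (h q)"
  shows "closure (h ` R) = h ` closure R"
    and "top_of_set (closure R) homeomorphic_space top_of_set (closure (h ` R))"
proof -
  define Q where "Q = closure R"
  \<comment> \<open>A positive constant is needed, both as a divisor and as a Lipschitz constant; no
    sign of \<open>L\<close> is assumed.\<close>
  define c where "c = max L 1"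
  have "closed {z :: 'c \<times> 'c. dist (fst z) (snd z) \<le> c * dist (h (fst z)) (h (snd z))}"
    by (intro closed_Collect_le continuous_intros continuous_on_compose2[OF h]) auto
  moreover have "R \<times> R \<subseteq> {z. dist (fst z) (snd z) \<le> c * dist (h (fst z)) (h (snd z))}"
  proof clarsimp
    fix p q assume "p \<in> R" "q \<in> R"
    then have "dist p q \<le> L * dist (h p) (h q)" by (rule expand)
    also have "\<dots> \<le> c * dist (h p) (h q)" by (intro mult_right_mono) (auto simp: c_def)
    finally show "dist p q \<le> c * dist (h p) (h q)" .
  qed
  ultimately have "closure (R \<times> R) \<subseteq> {z. dist (fst z) (snd z) \<le> c * dist (h (fst z)) (h (snd z))}"
    by (rule closure_minimal[rotated])
  then have expand_Q: "dist p q \<le> c * dist (h p) (h q)" if "p \<in> Q" "q \<in> Q" for p q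
    using that by (auto simp: closure_Times Q_def)
  have cpos: "c > 0" by (simp add: c_def)
  have "closed (h ` Q)"
    unfolding closed_sequential_limits
  proof (intro allI impI, elim conjE)
    fix x l assume x: "\<forall>k. x k \<in> h ` Q" "x \<longlonglongrightarrow> l"
    then have "\<forall>k. \<exists>p. p \<in> Q \<and> x k = h p" by blast
    from choice[OF this] obtain p where p: "\<forall>k. p k \<in> Q \<and> x k = h (p k)" ..
    have "Cauchy p"
      unfolding Cauchy_def
    proof (intro allI impI)
      fix e :: real assume "e > 0"
      then have "e / c > 0" using cpos by simp
      moreover have "Cauchy x" using x(2) by (rule LIMSEQ_imp_Cauchy)
      ultimately obtain K where K: "\<And>i j. K \<le> i \<Longrightarrow> K \<le> j \<Longrightarrow> dist (x i) (x j) < e / c"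
        unfolding Cauchy_def by metis
      have "dist (p i) (p j) < e" if "K \<le> i" "K \<le> j" for i j
      proof -
        have "dist (p i) (p j) \<le> c * dist (x i) (x j)" using expand_Q p by simp
        also have "\<dots> < c * (e / c)" using K[OF that] cpos by (intro mult_strict_left_mono)
        finally show ?thesis using cpos by simp
      qed
      then show "\<exists>M. \<forall>m\<ge>M. \<forall>n\<ge>M. dist (p m) (p n) < e" by blast
    qed
    then obtain q where q: "p \<longlonglongrightarrow> q" using Cauchy_convergent convergent_def by blast
    have "q \<in> Q" using closed_sequentially[of Q p q] p q by (simp add: Q_def)
    have "(\<lambda>k. h (p k)) \<longlonglongrightarrow> h q"
      using continuous_on_tendsto_compose[OF h q] by simp
    moreover have "(\<lambda>k. h (p k)) = x" using p by auto
    ultimately have "l = h q" using x(2) LIMSEQ_unique by blast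
    then show "l \<in> h ` Q" using \<open>q \<in> Q\<close> by blast
  qed
  moreover have "h ` R \<subseteq> h ` Q" using closure_subset by (auto simp: Q_def)
  ultimately have "closure (h ` R) \<subseteq> h ` Q" by (rule closure_minimal[rotated])
  moreover have "h ` Q \<subseteq> closure (h ` R)"
    unfolding Q_def using continuous_on_subset[OF h] by (intro image_closure_subset) (auto simp: closure_subset)
  ultimately show eq: "closure (h ` R) = h ` closure R" by (simp add: Q_def)
  have inj: "inj_on h Q"
  proof (rule inj_onI)
    fix p q assume "p \<in> Q" "q \<in> Q" "h p = h q"
    then show "p = q" using expand_Q[of p q] by simp
  qed
  define g where "g = inv_into Q h"
  have g: "g (h p) = p" if "p \<in> Q" for p using inj that by (simp add: g_def)
  have "c-lipschitz_on (h ` Q) g"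
    using expand_Q cpos by (auto simp: lipschitz_on_def g)
  then have "continuous_on (h ` Q) g" by (rule lipschitz_on_continuous_on)
  then have "homeomorphic_maps (top_of_set Q) (top_of_set (h ` Q)) h g"
    using g continuous_on_subset[OF h] by (auto simp: homeomorphic_maps_def continuous_map_in_subtopology)
  then show "top_of_set (closure R) homeomorphic_space top_of_set (closure (h ` R))"
    unfolding eq homeomorphic_space_def Q_def by blast
qed

text \<open>\<open>R\<close> is the graph of a bi-Lipschitz bijection between its projections. Both
  projections expand distances up to a factor, so the closures of \<open>fst\<close>
  R\<open>and\<close>snd \<open>R\<close> are both homeomorphic to the closure of \<open>R\<close>,
  and the former is a closed subset of \<open>S\<close>.\<close>

lemma covering_dim_le_bi_Lipschitz_closure:
  fixes R :: "('a::complete_space \<times> 'b::complete_space) set"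
  assumes fst_le: "\<And>p q. \<lbrakk>p \<in> R; q \<in> R\<rbrakk> \<Longrightarrow> dist (fst p) (fst q) \<le> K * dist (snd p) (snd q)"
    and snd_le: "\<And>p q. \<lbrakk>p \<in> R; q \<in> R\<rbrakk> \<Longrightarrow> dist (snd p) (snd q) \<le> K * dist (fst p) (fst q)"
    and S: "closed S" "fst ` R \<subseteq> S" and dim: "covering_dim_le (top_of_set S) n"
  shows "covering_dim_le (top_of_set (closure (snd ` R))) n"
proof -
  have le: "dist p q \<le> dist (fst p) (fst q) + dist (snd p) (snd q)" for p q :: "'a \<times> 'b"
    by (simp add: dist_prod_def sqrt_sum_squares_le_sum)
  have "dist p q \<le> (1 + K) * dist (fst p) (fst q)" "dist p q \<le> (1 + K) * dist (snd p) (snd q)"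
    if "p \<in> R" "q \<in> R" for p q
    using le[of p q] fst_le[OF that] snd_le[OF that] by (simp_all add: algebra_simps)
  then have hom: "top_of_set (closure R) homeomorphic_space top_of_set (closure (fst ` R))"
      "top_of_set (closure R) homeomorphic_space top_of_set (closure (snd ` R))"
    by (intro closure_image_expanding(2)[where L = "1 + K"] continuous_intros; simp)+
  have sub: "closure (fst ` R) \<subseteq> S" using S by (intro closure_minimal)
  then have "closedin (top_of_set S) (closure (fst ` R))" by (intro closed_subset closed_closure)
  from covering_dim_le_closed_subtopology[OF dim this]
  have dim_fst: "covering_dim_le (top_of_set (closure (fst ` R))) n"
    using sub by (simp add: subtopology_subtopology Int_absorb1)
  have "top_of_set (closure (fst ` R)) homeomorphic_space top_of_set (closure (snd ` R))"
    using hom(1)[THEN iffD1[OF homeomorphic_space_sym]] hom(2) by (rule homeomorphic_space_trans)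
  then show ?thesis using dim_fst by (rule covering_dim_le_homeomorphic)
qed

section \<open>Supports with respect to a free basis\<close>

instance bcontfun :: (metric_space, banach) banach ..

section \<open>Bump functions and a uniform bound for their extensions\<close>

text \<open>Height and radius are both \<open>r\<close>, which keeps the Lipschitz constant at 1 for
  every radius.\<close>

definition bump :: "'a::metric_space \<Rightarrow> real \<Rightarrow> 'a \<Rightarrow> real" where
  "bump a r x = max 0 (r - dist x a)"

lemma lipschitz_bump: "1-lipschitz_on M (bump a r)"
proof (rule lipschitz_onI)
  fix x y
  have "dist x a \<le> dist x y + dist y a" "dist y a \<le> dist x y + dist x a"
    by (metis dist_triangle) (metis dist_commute dist_triangle)
  then show "dist (bump a r x) (bump a r y) \<le> 1 * dist x y"
    by (auto simp: bump_def dist_real_def max_def)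
qed simp

text \<open>The constant does not depend on \<open>f\<close>. This uniformity lets bumps of
  arbitrary centre and radius yield estimates with one constant.\<close>

definition extension_bound :: "'x::banach set \<Rightarrow> real \<Rightarrow> bool" where
  "extension_bound M C \<longleftrightarrow> (\<forall>(f :: 'x \<Rightarrow> real) F. 1-lipschitz_on M f \<longrightarrow> f 0 = 0 \<longrightarrow> bounded_linear F \<longrightarrow>
     (\<forall>x\<in>M. F x = f x) \<longrightarrow> (\<forall>x. \<bar>F x\<bar> \<le> C * norm x))"

lemma extension_boundD:
  assumes "extension_bound M C" "1-lipschitz_on M f" "f 0 = 0" "bounded_linear F" "\<forall>x\<in>M. F x = f x"
  shows "\<bar>F x\<bar> \<le> C * norm x"
  using assms unfolding extension_bound_def by simp

lemma extension_bound_mono: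
  assumes "extension_bound M C" "C \<le> D"
  shows "extension_bound M D"
  unfolding extension_bound_def
proof (intro allI impI)
  fix f :: "'a \<Rightarrow> real" and F x
  assume "1-lipschitz_on M f" "f 0 = 0" "bounded_linear F" "\<forall>x\<in>M. F x = f x"
  with assms(1) have "\<bar>F x\<bar> \<le> C * norm x" by (rule extension_boundD)
  also have "\<dots> \<le> D * norm x" using assms(2) by (intro mult_right_mono) auto
  finally show "\<bar>F x\<bar> \<le> D * norm x" .
qed

text \<open>
  All 1-Lipschitz functions are the coordinates of a single 1-Lipschitz map into a space
  \<open>\<ell>\<^sup>\<infinity>(\<Gamma>)\<close>; a bound for its linear extension is a common bound for all of them.
\<close>

lemma free_basis_extension_bound:
  fixes M :: "'x::banach set"
  assumes M: "free_basis M"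
  shows "\<exists>C. extension_bound M C"
proof -
  \<comment> \<open>On the type \<open>discrete\<close> every function is continuous, so the bounded
    continuous functions on it are exactly the bounded families.\<close>
  define \<Gamma> where "\<Gamma> = {\<phi> :: ('x \<Rightarrow> real) discrete. 1-lipschitz_on M (of_discrete \<phi>) \<and> of_discrete \<phi> 0 = 0}"
  define ev :: "'x \<Rightarrow> ('x \<Rightarrow> real) discrete \<Rightarrow> real"
    \<comment> \<open>Coordinates outside \<open>\<Gamma>\<close> are set to 0; those in
      \<open>\<Gamma>\<close> are bounded by \<open>norm y\<close> for
      \<open>y \<in> M\<close>.\<close>
    where "ev y \<phi> = (if \<phi> \<in> \<Gamma> then of_discrete \<phi> y else 0)" for y \<phi>
  have 0: "0 \<in> M" using M by (simp add: free_basis_def)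
  have ev_diff: "dist (ev y \<phi>) (ev y' \<phi>) \<le> dist y y'" if "y \<in> M" "y' \<in> M" for y y' \<phi>
    using lipschitz_onD[OF _ that, of 1 "of_discrete \<phi>"] by (auto simp: ev_def \<Gamma>_def)
  have ev0: "ev 0 \<phi> = 0" for \<phi> by (simp add: ev_def \<Gamma>_def)
  define g where "g y = Bcontfun (ev y)" for y
  have g: "apply_bcontfun (g y) \<phi> = ev y \<phi>" if "y \<in> M" for y \<phi>
  proof -
    have "ev y \<in> bcontfun"
    proof (rule bcontfun_normI)
      show "continuous_on UNIV (ev y)"
        by (simp add: continuous_on_open_vimage open_discrete)
      show "norm (ev y \<phi>) \<le> norm y" for \<phi> using ev_diff[OF that 0, of \<phi>] by (simp add: ev0 dist_norm)
    qed
    then show ?thesis by (simp add: g_def Bcontfun_inverse)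
  qed
  have "1-lipschitz_on M g"
  proof (rule lipschitz_onI)
    fix y y' assume y: "y \<in> M" "y' \<in> M"
    show "dist (g y) (g y') \<le> 1 * dist y y'"
      using ev_diff[OF y] by (intro dist_bound) (simp add: g y)
  qed simp
  moreover have "g 0 = 0" by (intro bcontfun_eqI) (simp add: g 0 ev0)
  ultimately have "\<exists>!G. bounded_linear G \<and> (\<forall>x\<in>M. G x = g x)" by (rule free_basis_universal[OF M])
  then obtain G where G: "bounded_linear G" "\<forall>x\<in>M. G x = g x" by blast
  then obtain K where K: "\<And>y. norm (G y) \<le> norm y * K" using bounded_linear.bounded by blast
  have "extension_bound M K"
    unfolding extension_bound_def
  proof (intro allI impI)
    fix f :: "'x \<Rightarrow> real" and F x
    assume f: "1-lipschitz_on M f" "f 0 = 0" and F: "bounded_linear F" "\<forall>x\<in>M. F x = f x"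
    \<comment> \<open>The coordinate of \<open>G\<close> at \<open>f\<close> is a bounded linear
      extension of \<open>f\<close>, hence equal to \<open>F\<close> by uniqueness.\<close>
    define H where "H y = apply_bcontfun (G y) (discrete f)" for y
    have H_le: "\<bar>H y\<bar> \<le> norm y * K" for y
      using norm_bounded[of "G y" "discrete f"] K[of y] by (simp add: H_def)
    have "bounded_linear H"
    proof (rule bounded_linear_intro)
      show "norm (H y) \<le> norm y * K" for y using H_le by simp
    qed (simp_all add: H_def linear_add[OF bounded_linear.linear[OF G(1)]]
          linear_scale[OF bounded_linear.linear[OF G(1)]])
    moreover have "\<forall>y\<in>M. H y = f y"
      using G(2) f by (simp add: H_def g ev_def \<Gamma>_def discrete_inverse)
    ultimately have H: "bounded_linear H \<and> (\<forall>y\<in>M. H y = f y)" by blast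
    have F': "bounded_linear F \<and> (\<forall>y\<in>M. F y = f y)" using F by blast
    have "H = F"
      by (rule ex1_unique[where P = "\<lambda>F. bounded_linear F \<and> (\<forall>y\<in>M. F y = f y)",
            OF free_basis_universal[OF M f] H F'])
    then show "\<bar>F x\<bar> \<le> K * norm x" using H_le[of x] by (simp add: mult.commute)
  qed
  then show ?thesis ..
qed

section \<open>Coordinates, supports and their Lipschitz dependence\<close>

text \<open>A bump at \<open>v\<close> that vanishes at 0 and at the other vectors of a linear
  relation extends linearly. Applied to the relation, the extension isolates the coefficient of
  \<open>v\<close>.\<close>

lemma free_basis_independent:
  fixes M :: "'x::banach set"
  assumes M: "free_basis M"
  shows "independent (M - {0})"
proof
  assume "dependent (M - {0})"
  then obtain U u v where U: "finite U" "U \<subseteq> M - {0}" "v \<in> U" "u v \<noteq> 0" "(\<Sum>w\<in>U. u w *\<^sub>R w) = 0"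
    unfolding dependent_explicit by blast
  have "finite (insert 0 U)" using U(1) by simp
  from finite_set_avoid[OF this, of v] obtain r where r: "r > 0" "\<forall>w\<in>insert 0 U. w \<noteq> v \<longrightarrow> r \<le> dist v w"
    by (elim exE bexE conjE)
  have bump0: "bump v r w = 0" if "w \<in> insert 0 U" "w \<noteq> v" for w
    using r(2) that by (auto simp: bump_def dist_commute)
  have "v \<noteq> 0" using U by blast
  then have "bump v r 0 = 0" using bump0 by blast
  from free_basis_universal[OF M lipschitz_bump this]
  obtain F where F: "bounded_linear F" "\<forall>x\<in>M. F x = bump v r x" by blast
  have "0 = F (\<Sum>w\<in>U. u w *\<^sub>R w)" using U(5) bounded_linear.linear[OF F(1)] by (simp add: linear_0)
  also have "\<dots> = (\<Sum>w\<in>U. u w * F w)"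
    using bounded_linear.linear[OF F(1)] by (simp add: linear_sum linear_scale)
  also have "\<dots> = (\<Sum>w\<in>U. if w = v then u v * r else 0)"
    using F(2) U(2) bump0 r(1) by (intro sum.cong refl) (auto simp: bump_def)
  also have "\<dots> = u v * r" using U(1,3) by simp
  finally show False using U(4) r(1) by simp
qed

text \<open>The base point 0 lies in every free basis and is removed to obtain an independent set.
  Outside \<open>span M\<close> all coordinates are 0.\<close>

abbreviation coord :: "'x::banach set \<Rightarrow> 'x \<Rightarrow> 'x \<Rightarrow> real" where
  "coord M \<equiv> representation (M - {0})"

definition supp :: "'x::banach set \<Rightarrow> 'x \<Rightarrow> 'x set" where
  "supp M x = {b. coord M x b \<noteq> 0}"

lemma finite_supp: "finite (supp M x)"
  by (simp add: supp_def finite_representation)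

lemma supp_subset: "supp M x \<subseteq> M - {0}"
  using representation_ne_zero by (fastforce simp: supp_def)

lemma sum_supp_eq:
  assumes "free_basis M" "x \<in> span M"
  shows "(\<Sum>b\<in>supp M x. coord M x b *\<^sub>R b) = x"
  unfolding supp_def using assms
  by (intro sum_nonzero_representation_eq free_basis_independent) (simp_all add: span_delete_0)

lemma extension_eq_sum:
  fixes f :: "'x::banach \<Rightarrow> real"
  assumes M: "free_basis M" and F: "bounded_linear F" "\<forall>x\<in>M. F x = f x" and x: "x \<in> span M"
  shows "F x = (\<Sum>b\<in>supp M x. coord M x b * f b)"
proof -
  have "F x = F (\<Sum>b\<in>supp M x. coord M x b *\<^sub>R b)" by (simp add: sum_supp_eq[OF M x])
  also have "\<dots> = (\<Sum>b\<in>supp M x. coord M x b * F b)"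
    using bounded_linear.linear[OF F(1)] by (simp add: linear_sum linear_scale)
  also have "\<dots> = (\<Sum>b\<in>supp M x. coord M x b * f b)"
    using F(2) supp_subset by (intro sum.cong refl) fastforce
  finally show ?thesis .
qed

text \<open>The three bounds serve bumps of radius at most \<open>e\<close> at a support point: such
  a bump vanishes at 0 and on the rest of the support, and its extension takes at \<open>x\<close> a
  value of modulus at least \<open>e\<close> times the radius.\<close>

definition regular :: "'x::banach set \<Rightarrow> real \<Rightarrow> 'x \<Rightarrow> bool" where
  "regular M e x \<longleftrightarrow> (\<forall>b\<in>supp M x. e \<le> \<bar>coord M x b\<bar> \<and> e \<le> norm b \<and>
     (\<forall>b'\<in>supp M x. b' \<noteq> b \<longrightarrow> e \<le> dist b b'))"

lemma regular_antimono: "regular M e x \<Longrightarrow> d \<le> e \<Longrightarrow> regular M d x"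
  unfolding regular_def by (meson order_trans)

lemma ex_regular: "\<exists>e>0. regular M e x"
proof -
  define D where "D = (\<lambda>b. \<bar>coord M x b\<bar>) ` supp M x \<union> norm ` supp M x \<union>
      (\<lambda>(b, b'). dist b b') ` {z \<in> supp M x \<times> supp M x. fst z \<noteq> snd z}"
  have "finite D" by (auto simp: D_def finite_supp)
  from finite_set_avoid[OF this, of 0] obtain e where e: "e > 0" "\<forall>d\<in>D. d \<noteq> 0 \<longrightarrow> e \<le> dist 0 d"
    by (elim exE conjE)
  have "e \<le> d" if "d \<in> D" for d
  proof -
    have "d > 0" using that supp_subset[of M x] by (auto simp: D_def supp_def)
    then show ?thesis using e(2) that by force
  qed
  then have "regular M e x" by (force simp: regular_def D_def)
  then show ?thesis using e(1) by blast
qed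

text \<open>
  Testing \<open>x\<close> and \<open>y\<close> against the extension of a bump at \<open>b\<close> whose radius is proportional
  to \<open>dist x y\<close> shows that the support of \<open>y\<close> meets that bump.
\<close>

lemma supp_near:
  assumes M: "free_basis M" and C: "extension_bound M C" "C > 0"
    and e: "e > 0" "regular M e x" and xy: "x \<in> span M" "y \<in> span M"
    and b: "b \<in> supp M x" and small: "2 * C / e * dist x y \<le> e"
  shows "\<exists>b'\<in>supp M y. dist b b' \<le> 2 * C / e * dist x y"
proof (cases "x = y")
  case True
  then show ?thesis using b by auto
next
  case False
  \<comment> \<open>With this radius the extension \<open>F\<close> changes by at most
    \<open>e * r / 2\<close> between \<open>x\<close> and \<open>y\<close>, while its modulus at
    \<open>x\<close> is at least \<open>e * r\<close>. Hence it cannot vanish at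
    \<open>y\<close>.\<close>
  define r where "r = 2 * C / e * dist x y"
  have r: "r > 0" "r \<le> e" using False C(2) e(1) small by (simp_all add: r_def)
  have reg: "e \<le> \<bar>coord M x b\<bar>" "e \<le> norm b" "\<And>b'. b' \<in> supp M x \<Longrightarrow> b' \<noteq> b \<Longrightarrow> e \<le> dist b b'"
    using e(2) b by (simp_all add: regular_def)
  have bump0: "bump b r 0 = 0" using reg(2) r by (simp add: bump_def)
  from free_basis_universal[OF M lipschitz_bump bump0]
  obtain F where F: "bounded_linear F" "\<forall>z\<in>M. F z = bump b r z" by blast
  have "F x = (\<Sum>b'\<in>supp M x. coord M x b' * bump b r b')"
    by (rule extension_eq_sum[OF M F xy(1)])
  also have "\<dots> = (\<Sum>b'\<in>supp M x. if b' = b then coord M x b * r else 0)"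
    using reg(3) r by (intro sum.cong refl) (fastforce simp: bump_def dist_commute)
  also have "\<dots> = coord M x b * r" using b by (simp add: finite_supp)
  finally have Fx: "\<bar>F x\<bar> = \<bar>coord M x b\<bar> * r" using r by (simp add: abs_mult)
  have "\<bar>F x - F y\<bar> = \<bar>F (x - y)\<bar>"
    using bounded_linear.linear[OF F(1)] by (simp add: linear_diff)
  also have "\<dots> \<le> C * norm (x - y)"
    using C(1) lipschitz_bump bump0 F by (rule extension_boundD)
  also have "\<dots> = e * r / 2" using e(1) by (simp add: r_def dist_norm)
  also have "\<dots> < e * r" using e(1) r(1) by simp
  also have "\<dots> \<le> \<bar>F x\<bar>" unfolding Fx using reg(1) r(1) by (intro mult_right_mono) auto
  finally have "F y \<noteq> 0" by auto
  then have "(\<Sum>b'\<in>supp M y. coord M y b' * bump b r b') \<noteq> 0"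
    using extension_eq_sum[OF M F xy(2)] by simp
  then obtain b' where b': "b' \<in> supp M y" "coord M y b' * bump b r b' \<noteq> 0"
    by (meson sum.neutral)
  then have "dist b b' < r" by (auto simp: bump_def dist_commute max_def split: if_splits)
  then have "dist b b' \<le> 2 * C / e * dist x y" by (simp add: r_def)
  then show ?thesis using b'(1) by (rule bexI)
qed

text \<open>Some support point \<open>c\<close> of \<open>x'\<close> satisfies the Lipschitz
  estimate. If \<open>b'\<close> is already known to be roughly near \<open>b\<close>, then
  \<open>b'\<close> and \<open>c\<close> are closer than \<open>e\<close>, and regularity of
  \<open>x'\<close> forces \<open>c = b'\<close>.\<close>

lemma supp_matching:
  assumes M: "free_basis M" and C: "extension_bound M C" "C > 0" and e: "e > 0"
    and reg: "regular M e x" "regular M e x'" and span: "x \<in> span M" "x' \<in> span M"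
    and b: "b \<in> supp M x" "b' \<in> supp M x'"
    and s: "dist x x' \<le> s" "dist b b' \<le> s" "(2 * C / e + 1) * s < e"
  shows "dist b b' \<le> 2 * C / e * dist x x'"
proof -
  let ?K = "2 * C / e"
  have "?K > 0" using C(2) e by simp
  then have Ks: "?K * dist x x' \<le> ?K * s" using s(1) by (intro mult_left_mono) auto
  have s': "?K * s + s < e" using s(3) by (simp add: algebra_simps)
  have "0 \<le> s" using s(2) zero_le_dist[of b b'] by linarith
  then have small: "?K * dist x x' \<le> e" using Ks s' by linarith
  obtain c where c: "c \<in> supp M x'" "dist b c \<le> ?K * dist x x'"
    using supp_near[OF M C e reg(1) span b(1) small] by blast
  have "c = b'"
  proof (rule ccontr)
    assume "c \<noteq> b'"
    then have "e \<le> dist b' c" using reg(2) b(2) c(1) by (simp add: regular_def)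
    also have "\<dots> \<le> dist b b' + dist b c" by (metis dist_commute dist_triangle)
    finally show False using c(2) Ks s(2) s' by linarith
  qed
  then show ?thesis using c(2) by simp
qed

text \<open>Otherwise, expanding \<open>y\<close> over \<open>M\<close> and then each term over
  \<open>N\<close> would express \<open>y\<close> through the other elements of
  \<open>N - {0}\<close>, against independence.\<close>

lemma ex_mutual_support:
  assumes M: "free_basis M" and N: "free_basis N" and span: "span M = span N"
    and y: "y \<in> N - {0}"
  shows "\<exists>x\<in>supp M y. y \<in> supp N x"
proof (rule ccontr)
  assume neg: "\<not> ?thesis"
  have "x \<in> span (N - {0} - {y})" if x: "x \<in> supp M y" for x
  proof -
    have "x \<in> M" using supp_subset x by blast
    then have xs: "x \<in> span N" using span span_base by blast
    have "c \<in> N - {0} - {y}" if "c \<in> supp N x" for c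
      using that supp_subset neg x by blast
    then have "(\<Sum>c\<in>supp N x. coord N x c *\<^sub>R c) \<in> span (N - {0} - {y})"
      by (intro span_sum span_scale span_base)
    then show ?thesis by (simp add: sum_supp_eq[OF N xs])
  qed
  then have "(\<Sum>x\<in>supp M y. coord M y x *\<^sub>R x) \<in> span (N - {0} - {y})"
    by (intro span_sum span_scale)
  moreover have "y \<in> span M" using y span span_base by blast
  ultimately have "y \<in> span (N - {0} - {y})" by (simp add: sum_supp_eq[OF M])
  then show False using free_basis_independent[OF N] y unfolding dependent_def by blast
qed

section \<open>Invariance of the dimension\<close>

text \<open>A relation and not a map: several \<open>x\<close> may belong to one \<open>y\<close>,
  and conversely. It becomes a bijection only on small pieces.\<close>

definition mutual :: "'x::banach set \<Rightarrow> 'x set \<Rightarrow> real \<Rightarrow> ('x \<times> 'x) set" where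
  "mutual M N e = {(x, y). x \<in> supp M y \<and> y \<in> supp N x \<and> regular N e x \<and> regular M e y}"

text \<open>Near a fixed \<open>y0\<close> the partner \<open>x\<close> of \<open>y\<close> is close
  to one of the finitely many points of \<open>supp M y0\<close>. Fixing that point gives a piece on
  which \<open>x\<close> depends on \<open>y\<close> in a Lipschitz way, by supports over
  \<open>M\<close>, and \<open>y\<close> on \<open>x\<close>, by supports over
  \<open>N\<close>.\<close>

lemma sigma_dim_le_mutual:
  fixes M N :: "'x::banach set"
  assumes M: "free_basis M" and N: "free_basis N" and span: "span M = span N"
    and dim: "covering_dim_le (top_of_set M) n" and e: "e > 0"
  shows "sigma_dim_le N n (snd ` mutual M N e)"
proof -
  from free_basis_extension_bound[OF M] free_basis_extension_bound[OF N]
  obtain C1 C2 where C12: "extension_bound M C1" "extension_bound N C2" by (elim exE)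
  define C where "C = max 1 (max C1 C2)"
  have CM: "extension_bound M C" and CN: "extension_bound N C"
    using C12[THEN extension_bound_mono, of C] by (simp_all add: C_def)
  have C0: "C > 0" by (simp add: C_def)
  define K where "K = 2 * C / e"
  have K0: "K > 0" using C0 e by (simp add: K_def)
  \<comment> \<open>\<open>s\<close> is a diameter small enough for \<open>supp_matching\<close>, as
    \<open>(K + 1) * s = e / 2\<close>. The radius \<open>\<delta>\<close> makes both projections of
    \<open>R b\<close> have diameter at most \<open>s\<close>.\<close>
  define s where "s = e / (2 * (K + 1))"
  define \<delta> where "\<delta> = s / (2 * (K + 1))"
  have s0: "s > 0" and \<delta>0: "\<delta> > 0" using e K0 by (simp_all add: s_def \<delta>_def)
  have "(K + 1) * s = e / 2" using K0 by (simp add: s_def field_simps)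
  then have s: "(2 * C / e + 1) * s < e" using e by (simp add: K_def)
  have "(2 * (K + 1)) * \<delta> = s" using K0 by (simp add: \<delta>_def)
  then have eq: "2 * (K * \<delta>) + 2 * \<delta> = s" by (simp add: algebra_simps)
  have K\<delta>: "K * \<delta> > 0" using K0 \<delta>0 by simp
  have "s < e" using e K0 by (simp add: s_def field_simps add_pos_pos)
  have closedM: "closed M" and closedN: "closed N" using M N by (simp_all add: free_basis_def)
  have inM: "x \<in> M" "x \<in> span M" "x \<in> span N" and inN: "y \<in> N" "y \<in> span M" "y \<in> span N"
    if "(x, y) \<in> mutual M N e" for x y
  proof -
    show "x \<in> M" "y \<in> N" using that supp_subset by (auto simp: mutual_def)
    then show "x \<in> span M" "x \<in> span N" "y \<in> span M" "y \<in> span N"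
      using span span_base by blast+
  qed
  show ?thesis
  proof (rule sigma_dim_le_uniformly_local[OF _ \<delta>0])
    fix y0 assume "y0 \<in> snd ` mutual M N e"
    then have y0: "y0 \<in> span M" using inN(2) by auto
    define R where "R b = {p \<in> mutual M N e. dist (snd p) y0 < \<delta> \<and> dist (fst p) b \<le> K * \<delta>}" for b
    have "sigma_dim_le N n (snd ` R b)" for b
    proof (rule sigma_dim_le_closed[OF closed_closure])
      show "snd ` R b \<subseteq> closure (snd ` R b)" by (rule closure_subset)
      show "closure (snd ` R b) \<subseteq> N"
        using closedN inN(1) by (intro closure_minimal) (auto simp: R_def)
      have near: "dist (fst p) (fst q) \<le> s" "dist (snd p) (snd q) \<le> s" if "p \<in> R b" "q \<in> R b" for p q
      proof -
        have "dist (fst p) (fst q) \<le> dist (fst p) b + dist (fst q) b"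
          "dist (snd p) (snd q) \<le> dist (snd p) y0 + dist (snd q) y0"
          by (metis dist_commute dist_triangle)+
        then show "dist (fst p) (fst q) \<le> s" "dist (snd p) (snd q) \<le> s"
          using that eq \<delta>0 K\<delta> by (auto simp: R_def)
      qed
      show "covering_dim_le (top_of_set (closure (snd ` R b))) n"
      proof (rule covering_dim_le_bi_Lipschitz_closure[OF _ _ closedM _ dim])
        show "fst ` R b \<subseteq> M" using inM(1) by (auto simp: R_def)
        fix p q assume pq: "p \<in> R b" "q \<in> R b"
        obtain x y x' y' where xy: "p = (x, y)" "q = (x', y')" by (metis surj_pair)
        have P: "(x, y) \<in> mutual M N e" "(x', y') \<in> mutual M N e" using pq xy by (simp_all add: R_def)
        note P' = P[unfolded mutual_def, simplified]
        have d: "dist x x' \<le> s" "dist y y' \<le> s" using near[OF pq] xy by simp_all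
        show "dist (fst p) (fst q) \<le> K * dist (snd p) (snd q)"
          unfolding xy fst_conv snd_conv K_def
          by (rule supp_matching[OF M CM C0 e _ _ _ _ _ _ d(2,1) s]) (use P' inN[OF P(1)] inN[OF P(2)] in auto)
        show "dist (snd p) (snd q) \<le> K * dist (fst p) (fst q)"
          unfolding xy fst_conv snd_conv K_def
          by (rule supp_matching[OF N CN C0 e _ _ _ _ _ _ d s]) (use P' inM[OF P(1)] inM[OF P(2)] in auto)
      qed
    qed
    then have "sigma_dim_le N n (\<Union>b\<in>supp M y0. snd ` R b)"
      by (intro sigma_dim_le_UN countable_finite finite_supp)
    moreover have "snd ` mutual M N e \<inter> ball y0 \<delta> \<subseteq> (\<Union>b\<in>supp M y0. snd ` R b)"
    proof
      fix y assume "y \<in> snd ` mutual M N e \<inter> ball y0 \<delta>"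
      then obtain x where xy: "(x, y) \<in> mutual M N e" and y: "dist y y0 < \<delta>" by (auto simp: dist_commute)
      have K\<delta>': "K * dist y y0 \<le> K * \<delta>" using y K0 by (intro mult_left_mono) auto
      then have small: "2 * C / e * dist y y0 \<le> e"
        using eq \<delta>0 K\<delta> \<open>s < e\<close> unfolding K_def[symmetric] by linarith
      have "x \<in> supp M y" "regular M e y" using xy by (simp_all add: mutual_def)
      \<comment> \<open>The bump argument starts from \<open>y\<close>, whose regularity is known,
        and finds a support point of \<open>y0\<close>.\<close>
      then obtain b where b: "b \<in> supp M y0" "dist x b \<le> K * dist y y0"
        using supp_near[OF M CM C0 e _ inN(2)[OF xy] y0 _ small] unfolding K_def by blast
      then have "(x, y) \<in> R b" using xy y K\<delta>' by (simp add: R_def)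
      then show "y \<in> (\<Union>b\<in>supp M y0. snd ` R b)" using b(1) by force
    qed
    ultimately show "sigma_dim_le N n (snd ` mutual M N e \<inter> ball y0 \<delta>)" by (rule sigma_dim_le_mono)
  qed
qed

text \<open>Every point of \<open>N - {0}\<close> has a partner, and the pair is regular for some
  \<open>1 / real (Suc k)\<close>; so countably many sets \<open>mutual M N e\<close>
  suffice.\<close>

theorem free_basis_covering_dim_le:
  fixes M N :: "'x::banach set"
  assumes M: "free_basis M" and N: "free_basis N" and span: "span M = span N"
    and dim: "covering_dim_le (top_of_set M) n"
  shows "covering_dim_le (top_of_set N) n"
proof -
  have 0: "0 \<in> M" "0 \<in> N" using M N by (simp_all add: free_basis_def)
  have "N - {0} \<subseteq> (\<Union>k. snd ` mutual M N (1 / real (Suc k)))"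
  proof
    fix y assume y: "y \<in> N - {0}"
    obtain x where x: "x \<in> supp M y" "y \<in> supp N x" using ex_mutual_support[OF M N span y] by blast
    from ex_regular[of M y] ex_regular[of N x]
    obtain d1 d2 where d: "d1 > 0" "regular M d1 y" "d2 > 0" "regular N d2 x" by (elim exE conjE)
    obtain k where "1 / real (Suc k) < min d1 d2"
      using reals_Archimedean[of "min d1 d2"] d by (auto simp: inverse_eq_divide)
    then have "(x, y) \<in> mutual M N (1 / real (Suc k))"
      using x d by (auto simp: mutual_def intro: regular_antimono)
    then show "y \<in> (\<Union>k. snd ` mutual M N (1 / real (Suc k)))" by force
  qed
  moreover have "sigma_dim_le N n (\<Union>k. snd ` mutual M N (1 / real (Suc k)))"
    by (intro sigma_dim_le_UN sigma_dim_le_mutual[OF M N span dim]) auto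
  ultimately have "sigma_dim_le N n (N - {0})" by (rule sigma_dim_le_mono[rotated])
  \<comment> \<open>The point 0 lies in both bases, so its bound is inherited from
    \<open>M\<close>.\<close>
  moreover have "covering_dim_le (top_of_set {0::'x}) n"
    using covering_dim_le_closed_subtopology[OF dim, of "{0}"] 0
    by (simp add: subtopology_subtopology closed_subset)
  then have "sigma_dim_le N n {0}" using 0 by (intro sigma_dim_le_closed[of "{0}"]) auto
  ultimately have "sigma_dim_le N n (\<Union>b\<in>UNIV. if b then N - {0} else {0})"
    by (intro sigma_dim_le_UN) auto
  then have "sigma_dim_le N n N" by (rule sigma_dim_le_mono) (auto simp: UNIV_bool)
  then show ?thesis using 0 by (intro sigma_dim_le_imp_covering_dim_le) auto
qed

section \<open>Transfer from free bases to abstract metric spaces\<close>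

lemma bi_lipschitz_isomorphic_homeomorphic:
  assumes "bi_lipschitz_isomorphic M (submetric euclidean_metric S)"
  shows "mtopology_of M homeomorphic_space top_of_set S"
proof -
  obtain f g where fg: "Lipschitz_continuous_map M (submetric euclidean_metric S) f"
      "Lipschitz_continuous_map (submetric euclidean_metric S) M g"
      "\<forall>x\<in>mspace M. g (f x) = x" "\<forall>y\<in>mspace (submetric euclidean_metric S). f (g y) = y"
    using assms unfolding bi_lipschitz_isomorphic_def by blast
  have "homeomorphic_maps (mtopology_of M) (mtopology_of (submetric euclidean_metric S)) f g"
    using fg(1,2)[THEN Lipschitz_continuous_imp_continuous_map] fg(3,4) by (simp add: homeomorphic_maps_def)
  then show ?thesis
    by (auto simp: homeomorphic_space_def mtopology_of_submetric)
qed

theorem corollary4p4: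
  fixes M :: "'a metric" and N :: "'b metric"
  assumes "mcomplete_of M" and "mcomplete_of N"
    and "Mol_equivalent TYPE('x::banach) M N"
  shows "covering_dim (mtopology_of M) = covering_dim (mtopology_of N)"
proof -
  obtain M' N' :: "'x set" where free: "free_basis M'" "free_basis N'"
    and iso: "bi_lipschitz_isomorphic M (submetric euclidean_metric M')"
      "bi_lipschitz_isomorphic N (submetric euclidean_metric N')"
    and span: "span M' = span N'"
    using assms(3) unfolding Mol_equivalent_def by blast
  \<comment> \<open>Every bound \<open>n\<close> passes in both directions, so the two infima run
    over the same set, which includes the case of infinite dimension.\<close>
  have "covering_dim_le (top_of_set M') n \<longleftrightarrow> covering_dim_le (top_of_set N') n" for n
    using free_basis_covering_dim_le[OF free span] free_basis_covering_dim_le[OF free(2,1) span[symmetric]]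
    by blast
  then have "covering_dim (top_of_set M') = covering_dim (top_of_set N')"
    by (simp add: covering_dim_def)
  then show ?thesis
    using iso[THEN bi_lipschitz_isomorphic_homeomorphic, THEN covering_dim_homeomorphic] by simp
qed

end
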